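(* Let $A\in\mathbb{R}^{n\times n}$ satisfy $A^\top=-A$ and let $T>0$. Then $$r(A,T)=\sum_{\zeta\in\sigma(e^{TA_{\mathbb{C}}})}m_\zeta(T).$$ Equivalently, for every $k\in\{1,\ldots,n\}$, $$\gamma_k(A,T)=\gamma_{\mathrm{rel}}(A,T)=\frac Tn\iff k\geq\sum_{\zeta\in\sigma(e^{TA_{\mathbb{C}}})}m_\zeta(T).$$ In particular, if all endpoint phases are distinct (i.e. $e^{i\omega T}\neq e^{i\nu T}$ for distinct $\omega,\nu\in\Omega$), then $r(A,T)=n$; if all phases coincide, then $r(A,T)=\max_{\omega\in\Omega}\mu_\omega$.
   Context: For a real symmetric $n\times n$ matrix $X$, $\mathcal{G}_T(X)=\int_0^Te^{tA}Xe^{tA^\top}\,dt$. For $k\in\{1,\ldots,n\}$, $\gamma_k(A,T)=\max\{\lambda_{\min}(\mathcal{G}_T(X))\mid X\succeq0,\ \operatorname{tr}X=1,\ \operatorname{rank}X\leq k\}$, $\gamma_{\mathrm{rel}}(A,T)=\gamma_n(A,T)$, and $r(A,T)=\min\{\operatorname{rank}X\mid X\succeq0,\ \operatorname{tr}X=1,\ \lambda_{\min}(\mathcal{G}_T(X))=\gamma_{\mathrm{rel}}(A,T)\}$ (all $X$ real symmetric). $A_{\mathbb{C}}$ is the complexification of $A$, and $\mathbb{C}^n=\bigoplus_{\omega\in\Omega}E_\omega$ with $E_\omega=\ker(A_{\mathbb{C}}-i\omega\,\mathrm{Id})$, where $\Omega\subset\mathbb{R}$ is the finite set of distinct signed frequencies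 (those $\omega$ with $E_\omega\ne\{0\}$, including $0$ when $\ker A\neq\{0\}$); $\mu_\omega=\dim_{\mathbb{C}}E_\omega$. For $\zeta\in\sigma(e^{TA_{\mathbb{C}}})$ (the set of distinct eigenvalues), $\Omega_\zeta(T)=\{\omega\in\Omega\mid e^{i\omega T}=\zeta\}$ and $m_\zeta(T)=\max_{\omega\in\Omega_\zeta(T)}\mu_\omega$. *)

theory Defs
  imports "HOL-Analysis.Analysis"
begin

(* The library has no exponential on square matrices, and its power operation on the vector type
   is componentwise, so the powers in the exponential series are iterated matrix products. *)
definition mat_exp :: "'a::real_normed_field^'n^'n \<Rightarrow> 'a^'n^'n" where
  "mat_exp A = (\<Sum>k. (1 / fact k :: real) *\<^sub>R ((\<lambda>M. A ** M) ^^ k) (mat 1))"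

definition eigenvalues :: "'a::field^'n^'n \<Rightarrow> 'a set" where
  "eigenvalues M = {c. \<exists>v. v \<noteq> 0 \<and> M *v v = c *s v}"

(* Used for symmetric matrices only, where the spectrum is finite and nonempty. *)
definition lambda_min :: "real^'n^'n \<Rightarrow> real" where
  "lambda_min M = Min (eigenvalues M)"

definition psd :: "real^'n^'n \<Rightarrow> bool" where
  "psd X \<longleftrightarrow> transpose X = X \<and> (\<forall>v. 0 \<le> v \<bullet> (X *v v))"

definition gramian :: "real^'n^'n \<Rightarrow> real \<Rightarrow> real^'n^'n \<Rightarrow> real^'n^'n" where
  "gramian A T X =
     integral {0..T} (\<lambda>t. mat_exp (t *\<^sub>R A) ** X ** mat_exp (t *\<^sub>R transpose A))"

(* GREATEST denotes an attained maximum; it is unspecified where there is none. *)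
definition gamma :: "nat \<Rightarrow> real^'n^'n \<Rightarrow> real \<Rightarrow> real" where
  "gamma k A T = (GREATEST g. \<exists>X. psd X \<and> trace X = 1 \<and> rank X \<le> k \<and>
                                  g = lambda_min (gramian A T X))"

definition gamma_rel :: "real^'n^'n \<Rightarrow> real \<Rightarrow> real" where
  "gamma_rel A T = gamma CARD('n) A T"

definition min_rank :: "real^'n^'n \<Rightarrow> real \<Rightarrow> nat" where
  "min_rank A T = (LEAST d. \<exists>X. psd X \<and> trace X = 1 \<and>
                               lambda_min (gramian A T X) = gamma_rel A T \<and> d = rank X)"

definition complexify :: "real^'n^'n \<Rightarrow> complex^'n^'n" where
  "complexify A = map_matrix complex_of_real A"

definition eigspace :: "real^'n^'n \<Rightarrow> real \<Rightarrow> (complex^'n) set" where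
  "eigspace A \<omega> = {v. (complexify A - mat (\<i> * of_real \<omega>)) *v v = 0}"

definition freqs :: "real^'n^'n \<Rightarrow> real set" where
  "freqs A = {\<omega>. eigspace A \<omega> \<noteq> {0}}"

(* vec.dim is the dimension over the scalar field, here complex; plain dim would be the real one. *)
definition freq_mult :: "real^'n^'n \<Rightarrow> real \<Rightarrow> nat" where
  "freq_mult A \<omega> = vec.dim (eigspace A \<omega>)"

definition phase :: "real \<Rightarrow> real \<Rightarrow> complex" where
  "phase T \<omega> = exp (\<i> * of_real (\<omega> * T))"

definition phase_spectrum :: "real^'n^'n \<Rightarrow> real \<Rightarrow> complex set" where
  "phase_spectrum A T = eigenvalues (mat_exp (T *\<^sub>R complexify A))"

definition freqs_at :: "real^'n^'n \<Rightarrow> real \<Rightarrow> complex \<Rightarrow> real set" where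
  "freqs_at A T \<zeta> = {\<omega> \<in> freqs A. phase T \<omega> = \<zeta>}"

definition max_mult :: "real^'n^'n \<Rightarrow> real \<Rightarrow> complex \<Rightarrow> nat" where
  "max_mult A T \<zeta> = Max (freq_mult A ` freqs_at A T \<zeta>)"

end

theory Submission
  imports Defs
begin

text \<open>
  The Gramian has trace \<open>T\<close> whenever \<open>X\<close> has trace 1, so the optimal value \<open>T/n\<close> is reached exactly
  when the Gramian is \<open>T/n\<close> times the identity. Since \<open>exp(tA)\<close> acts on the eigenspace of \<open>\<omega>\<close> as
  \<open>exp(i\<omega>t)\<close>, a block of the Gramian is the corresponding block of \<open>X\<close> times the integral of
  \<open>exp(i(\<omega>-\<nu>)t)\<close>, which vanishes iff \<open>\<omega> \<noteq> \<nu>\<close> have the same endpoint phase. Optimality therefore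
  makes the diagonal blocks of \<open>X\<close> equal to \<open>1/n\<close> and the blocks between different phases zero, and
  leaves all other blocks free. Restricting \<open>X\<close> to one eigenspace of maximal dimension per phase bounds
  its rank from below. The bound is attained by \<open>1/n\<close> times the sum of the matrices \<open>v v*\<close>, where,
  for each phase and each index \<open>j\<close>, the vector \<open>v\<close> is the sum of the \<open>j\<close>-th members of orthonormal
  bases of the eigenspaces with that phase; taking the bases for \<open>\<omega>\<close> and \<open>-\<omega>\<close> complex conjugate makes
  this matrix real. For smaller ranks the maximum defining \<open>\<gamma>\<close> exists by compactness, hence it is
  strictly below \<open>T/n\<close>.
\<close>

subsection \<open>The Hermitian form and real structure of complex vectors\<close>

text \<open>The type-class inner product on \<open>complex^'n\<close> is only the real part of this
  Hermitian form, so it cannot express orthogonality over the complex numbers.\<close>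

definition cdot :: "complex^'n \<Rightarrow> complex^'n \<Rightarrow> complex" where
  "cdot u v = (\<Sum>i\<in>UNIV. u $ i * cnj (v $ i))"

definition cnjv :: "complex^'n \<Rightarrow> complex^'n" where
  "cnjv v = (\<chi> i. cnj (v $ i))"

definition cvec :: "real^'n \<Rightarrow> complex^'n" where
  "cvec x = (\<chi> i. complex_of_real (x $ i))"

lemma cdot_0_left [simp]: "cdot 0 v = 0" and cdot_0_right [simp]: "cdot u 0 = 0"
  by (simp_all add: cdot_def)

lemma cdot_add_left: "cdot (u + v) w = cdot u w + cdot v w"
  by (simp add: cdot_def algebra_simps sum.distrib)

lemma cdot_diff_left: "cdot (u - v) w = cdot u w - cdot v w"
  by (simp add: cdot_def algebra_simps sum_subtractf)

lemma cdot_scale_left: "cdot (c *s u) w = c * cdot u w"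
  by (simp add: cdot_def sum_distrib_left algebra_simps)

lemma cdot_sum_left: "cdot (\<Sum>p\<in>P. f p) w = (\<Sum>p\<in>P. cdot (f p) w)"
  by (induction P rule: infinite_finite_induct) (simp_all add: cdot_add_left)

lemma cnj_cdot: "cnj (cdot u v) = cdot v u"
  by (simp add: cdot_def mult.commute)

lemma cdot_scale_right: "cdot u (c *s w) = cnj c * cdot u w"
  by (metis cdot_scale_left cnj_cdot complex_cnj_mult)

lemma cdot_sum_right: "cdot w (\<Sum>p\<in>P. f p) = (\<Sum>p\<in>P. cdot w (f p))"
  by (induction P rule: infinite_finite_induct)
     (simp_all, metis cdot_add_left cnj_cdot complex_cnj_add)

lemma inner_eq_Re_cdot: "u \<bullet> v = Re (cdot u v)"
  by (simp add: inner_vec_def cdot_def inner_complex_def)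

lemma cdot_self: "cdot v v = complex_of_real ((norm v)\<^sup>2)"
proof (rule complex_eqI)
  show "Re (cdot v v) = Re (complex_of_real ((norm v)\<^sup>2))"
    by (simp flip: inner_eq_Re_cdot add: power2_norm_eq_inner)
  have "cnj (cdot v v) = cdot v v" by (rule cnj_cdot)
  then show "Im (cdot v v) = Im (complex_of_real ((norm v)\<^sup>2))"
    by (metis Im_complex_of_real Reals_cnj_iff complex_is_Real_iff)
qed

lemma cdot_cnjv: "cdot (cnjv u) (cnjv v) = cnj (cdot u v)"
  by (simp add: cdot_def cnjv_def)

lemma cnjv_cnjv [simp]: "cnjv (cnjv v) = v"
  by (simp add: cnjv_def vec_eq_iff)

lemma cnjv_0 [simp]: "cnjv 0 = 0"
  by (simp add: cnjv_def vec_eq_iff)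

lemma cnjv_eq_0 [simp]: "cnjv v = 0 \<longleftrightarrow> v = 0"
  by (metis cnjv_0 cnjv_cnjv)

lemma cnjv_scale: "cnjv (c *s v) = cnj c *s cnjv v"
  by (simp add: cnjv_def vec_eq_iff)

lemma cnjv_sum: "cnjv (\<Sum>p\<in>P. f p) = (\<Sum>p\<in>P. cnjv (f p))"
  by (simp add: cnjv_def vec_eq_iff sum_component)

lemma cdot_cvec: "cdot (cvec x) (cvec y) = complex_of_real (x \<bullet> y)"
  by (simp add: cdot_def cvec_def inner_vec_def)

lemma cnjv_cvec [simp]: "cnjv (cvec x) = cvec x"
  by (simp add: cnjv_def cvec_def vec_eq_iff)

lemma cvec_0 [simp]: "cvec 0 = 0"
  by (simp add: cvec_def vec_eq_iff)

lemma cvec_add: "cvec (x + y) = cvec x + cvec y"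
  by (simp add: cvec_def vec_eq_iff)

lemma cvec_scaleR: "cvec (c *\<^sub>R x) = complex_of_real c *s cvec x"
  by (simp add: cvec_def vec_eq_iff)

lemma cvec_sum: "cvec (\<Sum>p\<in>P. f p) = (\<Sum>p\<in>P. cvec (f p))"
  by (simp add: cvec_def vec_eq_iff sum_component)

lemma cvec_eq_iff [simp]: "cvec x = cvec y \<longleftrightarrow> x = y"
  by (simp add: cvec_def vec_eq_iff)

definition Re_vec :: "complex^'n \<Rightarrow> real^'n" where
  "Re_vec v = (\<chi> i. Re (v $ i))"

definition Im_vec :: "complex^'n \<Rightarrow> real^'n" where
  "Im_vec v = (\<chi> i. Im (v $ i))"

lemma cvec_Re_Im: "v = cvec (Re_vec v) + \<i> *s cvec (Im_vec v)"
  by (simp add: cvec_def Re_vec_def Im_vec_def vec_eq_iff complex_eq_iff)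

lemma complexify_cvec: "complexify A *v cvec x = cvec (A *v x)"
  by (simp add: complexify_def cvec_def matrix_vector_mult_def vec_eq_iff)

lemma cnjv_complexify: "cnjv (complexify A *v v) = complexify A *v cnjv v"
  by (simp add: cnjv_def complexify_def matrix_vector_mult_def vec_eq_iff)

lemma complexify_mult: "complexify (A ** B) = complexify A ** complexify B"
  by (simp add: complexify_def matrix_matrix_mult_def vec_eq_iff)

lemma complexify_mat_1 [simp]: "complexify (mat 1) = mat 1"
  by (simp add: complexify_def mat_def vec_eq_iff)

lemma complexify_eq_iff [simp]: "complexify A = complexify B \<longleftrightarrow> A = B"
  by (simp add: complexify_def vec_eq_iff)

lemma complexify_scaleR: "complexify (c *\<^sub>R A) = c *\<^sub>R complexify A" for c :: real
  by (simp add: complexify_def vec_eq_iff complex_eq_iff)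

lemma cdot_complexify: "cdot (complexify X *v u) v = cdot u (complexify (transpose X) *v v)"
proof -
  have "cdot (complexify X *v u) v = (\<Sum>i\<in>UNIV. \<Sum>j\<in>UNIV. X $ i $ j * u $ j * cnj (v $ i))"
    by (simp add: cdot_def complexify_def matrix_vector_mult_def sum_distrib_right)
  also have "\<dots> = (\<Sum>j\<in>UNIV. \<Sum>i\<in>UNIV. X $ i $ j * u $ j * cnj (v $ i))"
    by (rule sum.swap)
  also have "\<dots> = cdot u (complexify (transpose X) *v v)"
    by (simp add: cdot_def complexify_def matrix_vector_mult_def transpose_def sum_distrib_left algebra_simps)
  finally show ?thesis .
qed

lemma matrix_vector_scale: "M *v (c *s v) = c *s (M *v v)" for M :: "'a::field^'n^'m"
  by (simp add: matrix_vector_mult_def vec_eq_iff sum_distrib_left algebra_simps)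

lemma matrix_vector_sum: "M *v (\<Sum>p\<in>P. f p) = (\<Sum>p\<in>P. M *v f p)" for M :: "'a::field^'n^'m"
  by (induction P rule: infinite_finite_induct) (simp_all add: matrix_vector_right_distrib)

section \<open>Self-adjoint maps and minima of their quadratic forms\<close>

text \<open>The zero \<open>x\<close> minimises the form on \<open>W\<close>, so its derivative in
  every direction of \<open>W\<close> vanishes. This turns minimisers into eigenvectors and later
  settles the equality case of the trace bound.\<close>

lemma nonneg_form_zero:
  fixes f :: "'a::real_inner \<Rightarrow> 'a"
  assumes lin: "linear f" and sa: "\<And>x y. f x \<bullet> y = x \<bullet> f y" and W: "subspace W"
    and nn: "\<And>y. y \<in> W \<Longrightarrow> 0 \<le> y \<bullet> f y" and x: "x \<in> W" "x \<bullet> f x = 0" and y: "y \<in> W"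
  shows "f x \<bullet> y = 0"
proof (rule ccontr)
  define b where "b = f x \<bullet> y"
  define c where "c = y \<bullet> f y"
  assume "f x \<bullet> y \<noteq> 0"
  then have b: "b \<noteq> 0" by (simp add: b_def)
  have c: "0 \<le> c" using nn y by (simp add: c_def)
  have quad: "0 \<le> 2 * t * b + t\<^sup>2 * c" for t
  proof -
    have "x + t *\<^sub>R y \<in> W" using W x y by (simp add: subspace_add subspace_scale)
    then have "0 \<le> (x + t *\<^sub>R y) \<bullet> f (x + t *\<^sub>R y)" by (rule nn)
    also have "\<dots> = 2 * t * b + t\<^sup>2 * c"
      using x(2) sa[of x y]
      by (simp add: linear_add[OF lin] linear_scale[OF lin] inner_add_left inner_add_right b_def c_def
          power2_eq_square algebra_simps inner_commute)
    finally show ?thesis .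
  qed
  \<comment> \<open>The quadratic is smallest at \<open>- b / c\<close>; adding 1 to the denominator
    also covers \<open>c = 0\<close>.\<close>
  have "2 * (- b / (c + 1)) * b + (- b / (c + 1))\<^sup>2 * c = - (b\<^sup>2 * (c + 2)) / (c + 1)\<^sup>2"
    using c by (simp add: divide_simps power2_eq_square) (simp add: algebra_simps)
  moreover have "\<dots> < 0"
    using b c by (simp add: divide_neg_pos)
  ultimately show False using quad[of "- b / (c + 1)"] by linarith
qed

text \<open>The form attains its minimum on the unit sphere of \<open>W\<close> by compactness.
  Allowing an invariant subspace of any Euclidean space covers both symmetric real matrices and
  complex vectors regarded as a real space.\<close>

lemma selfadjoint_min_eigenvector:
  fixes f :: "'a::euclidean_space \<Rightarrow> 'a"
  assumes lin: "linear f" and sa: "\<And>x y. f x \<bullet> y = x \<bullet> f y" and W: "subspace W" "W \<noteq> {0}"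
    and inv: "\<And>x. x \<in> W \<Longrightarrow> f x \<in> W"
  obtains x l where "x \<in> W" "norm x = 1" "f x = l *\<^sub>R x" "\<And>y. y \<in> W \<Longrightarrow> l * (y \<bullet> y) \<le> y \<bullet> f y"
proof -
  have "compact (W \<inter> sphere 0 1)"
    by (simp add: closed_Int_compact closed_subspace W)
  moreover obtain w where w: "w \<in> W" "w \<noteq> 0" using W subspace_0 by blast
  then have "(1 / norm w) *\<^sub>R w \<in> W \<inter> sphere 0 1"
    using W by (simp add: subspace_scale)
  then have "W \<inter> sphere 0 1 \<noteq> {}" by blast
  moreover have "continuous_on (W \<inter> sphere 0 1) (\<lambda>y. y \<bullet> f y)"
    by (intro continuous_intros linear_continuous_on linear_conv_bounded_linear[THEN iffD1] lin)
  ultimately obtain x where x: "x \<in> W \<inter> sphere 0 1"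
      and mn: "\<And>y. y \<in> W \<inter> sphere 0 1 \<Longrightarrow> x \<bullet> f x \<le> y \<bullet> f y"
    using continuous_attains_inf[of "W \<inter> sphere 0 1" "\<lambda>y. y \<bullet> f y"] by metis
  define l where "l = x \<bullet> f x"
  have xx: "x \<in> W" "norm x = 1" "x \<bullet> x = 1" using x by (auto simp: norm_eq_1)
  have bound: "l * (y \<bullet> y) \<le> y \<bullet> f y" if "y \<in> W" for y
  proof (cases "y = 0")
    case False
    have "(1 / norm y) *\<^sub>R y \<in> W \<inter> sphere 0 1"
      using W that False by (simp add: subspace_scale)
    from mn[OF this] have "l \<le> (1 / norm y)\<^sup>2 * (y \<bullet> f y)"
      by (simp add: l_def linear_scale[OF lin] power2_eq_square)
    then have "l * (norm y)\<^sup>2 \<le> y \<bullet> f y"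
      using False by (simp add: field_simps)
    then show ?thesis by (simp add: power2_norm_eq_inner)
  qed (simp add: linear_0[OF lin])
  \<comment> \<open>The shifted form is nonnegative on \<open>W\<close> and zero at
    \<open>x\<close>; testing it against \<open>g x\<close>, which lies in \<open>W\<close> by
    invariance, gives \<open>g x = 0\<close>.\<close>
  define g where "g y = f y - l *\<^sub>R y" for y
  have "linear g"
    unfolding g_def by (intro linear_compose_sub lin linear_scale_self)
  moreover have "g a \<bullet> b = a \<bullet> g b" for a b
    by (simp add: g_def inner_diff_left inner_diff_right sa)
  moreover have "0 \<le> y \<bullet> g y" if "y \<in> W" for y
    using bound[OF that] by (simp add: g_def inner_diff_right)
  moreover have "x \<bullet> g x = 0" by (simp add: g_def inner_diff_right xx l_def)
  moreover have "g x \<in> W"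
    using W xx inv by (simp add: g_def subspace_diff subspace_scale)
  ultimately have "g x \<bullet> g x = 0"
    using nonneg_form_zero[of g W x "g x"] W xx by blast
  then have "f x = l *\<^sub>R x" by (simp add: g_def)
  with xx bound that show ?thesis by blast
qed

section \<open>Orthonormal families and complex dimension\<close>

text \<open>Pairing a linear relation with \<open>d q\<close> isolates the coefficient of
  \<open>g q\<close>. The two families differ in the rank bound, where \<open>g\<close> is the image
  of \<open>d\<close> under a matrix.\<close>

lemma biorthogonal_independent:
  assumes fin: "finite P"
    and bi: "\<And>p q. p \<in> P \<Longrightarrow> q \<in> P \<Longrightarrow> cdot (g p) (d q) = (if p = q then c else 0)" and c: "c \<noteq> 0"
  shows "inj_on g P" "vec.independent (g ` P)"
proof -
  show inj: "inj_on g P"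
  proof (rule inj_onI)
    fix p q assume "p \<in> P" "q \<in> P" "g p = g q"
    then show "p = q" using bi[of p q] bi[of q q] c by (auto split: if_splits)
  qed
  show "vec.independent (g ` P)"
  proof (rule vec.independent_if_scalars_zero)
    show "finite (g ` P)" using fin by simp
    fix f x assume s: "(\<Sum>x\<in>g ` P. f x *s x) = 0" and "x \<in> g ` P"
    then obtain q where q: "q \<in> P" "x = g q" by blast
    have "0 = cdot (\<Sum>p\<in>P. f (g p) *s g p) (d q)"
      using s by (simp add: sum.reindex[OF inj])
    also have "\<dots> = (\<Sum>p\<in>P. f (g p) * (if p = q then c else 0))"
      by (simp add: cdot_sum_left cdot_scale_left bi q)
    also have "\<dots> = f x * c"
      using fin q by (simp add: if_distrib cong: if_cong)
    finally show "f x = 0" using c by simp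
  qed
qed

definition orthonormal_family :: "'b set \<Rightarrow> ('b \<Rightarrow> complex^'n) \<Rightarrow> bool" where
  "orthonormal_family P e \<longleftrightarrow> (\<forall>p\<in>P. \<forall>q\<in>P. cdot (e p) (e q) = (if p = q then 1 else 0))"

lemma orthonormal_family_card_le:
  assumes "finite P" "orthonormal_family P e" "\<And>p. p \<in> P \<Longrightarrow> e p \<in> S"
  shows "card P \<le> vec.dim S"
proof -
  have "inj_on e P" "vec.independent (e ` P)"
    using biorthogonal_independent[of P e e 1] assms by (auto simp: orthonormal_family_def)
  then show ?thesis
    using vec.independent_card_le_dim[of "e ` P" S] assms(3) by (simp add: card_image image_subset_iff)
qed

lemma orthonormal_family_card_eq:
  assumes "finite P" "orthonormal_family P e" "\<And>p. p \<in> P \<Longrightarrow> e p \<in> S"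
    and "\<And>v. v \<in> S \<Longrightarrow> v = (\<Sum>p\<in>P. cdot v (e p) *s e p)"
  shows "card P = vec.dim S"
proof (rule antisym)
  show "card P \<le> vec.dim S" using orthonormal_family_card_le assms by blast
  have "S \<subseteq> vec.span (e ` P)"
  proof
    fix v assume "v \<in> S"
    then have v: "v = (\<Sum>p\<in>P. cdot v (e p) *s e p)" by (rule assms(4))
    have "(\<Sum>p\<in>P. cdot v (e p) *s e p) \<in> vec.span (e ` P)"
      by (intro vec.span_sum vec.span_scale vec.span_base) auto
    then show "v \<in> vec.span (e ` P)" by (simp flip: v)
  qed
  then have "vec.dim S \<le> card (e ` P)"
    using assms(1) vec.dim_le_card by blast
  also have "\<dots> \<le> card P" by (rule card_image_le[OF assms(1)])
  finally show "vec.dim S \<le> card P" .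
qed

lemma orthonormal_residual:
  assumes "finite P" "orthonormal_family P e" "q \<in> P"
  shows "cdot (v - (\<Sum>p\<in>P. cdot v (e p) *s e p)) (e q) = 0"
proof -
  have "(\<Sum>p\<in>P. cdot v (e p) * cdot (e p) (e q)) = (\<Sum>p\<in>P. cdot v (e p) * (if p = q then 1 else 0))"
    using assms by (intro sum.cong) (auto simp: orthonormal_family_def)
  also have "\<dots> = cdot v (e q)" using assms by (simp add: if_distrib cong: if_cong)
  finally show ?thesis by (simp add: cdot_diff_left cdot_sum_left cdot_scale_left)
qed

text \<open>An orthonormal family of maximal length in \<open>S\<close> spans it, since otherwise a
  normalised residual would extend the family.\<close>

lemma orthonormal_basis_exists:
  fixes S :: "(complex^'n) set"
  assumes S: "vec.subspace S"
  obtains e :: "nat \<Rightarrow> complex^'n" where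
    "\<And>j. j < vec.dim S \<Longrightarrow> e j \<in> S" "orthonormal_family {..<vec.dim S} e"
    "\<And>v. v \<in> S \<Longrightarrow> v = (\<Sum>j<vec.dim S. cdot v (e j) *s e j)"
proof -
  define Q where "Q m \<longleftrightarrow> (\<exists>e::nat \<Rightarrow> complex^'n. (\<forall>j<m. e j \<in> S) \<and> orthonormal_family {..<m} e)" for m
  have Q0: "Q 0" by (auto simp: Q_def orthonormal_family_def)
  have le: "m \<le> vec.dim S" if Qm: "Q m" for m
  proof -
    obtain e :: "nat \<Rightarrow> complex^'n" where e: "\<forall>j<m. e j \<in> S" "orthonormal_family {..<m} e"
      using Qm by (auto simp: Q_def)
    then show ?thesis using orthonormal_family_card_le[of "{..<m}" e S] by simp
  qed
  define m where "m = (GREATEST m. Q m)"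
  have "Q m" unfolding m_def using GreatestI_nat[of Q 0] Q0 le by blast
  then obtain e :: "nat \<Rightarrow> complex^'n" where e: "\<And>j. j < m \<Longrightarrow> e j \<in> S" "orthonormal_family {..<m} e"
    by (auto simp: Q_def)
  have sp: "v = (\<Sum>j<m. cdot v (e j) *s e j)" if v: "v \<in> S" for v
  proof (rule ccontr)
    define r where "r = v - (\<Sum>j<m. cdot v (e j) *s e j)"
    assume "v \<noteq> (\<Sum>j<m. cdot v (e j) *s e j)"
    then have r0: "r \<noteq> 0" by (simp add: r_def)
    have rS: "r \<in> S" unfolding r_def
      using S v e(1) by (intro vec.subspace_diff vec.subspace_sum vec.subspace_scale) auto
    have ro: "cdot r (e j) = 0" if "j < m" for j
      unfolding r_def using orthonormal_residual[of "{..<m}" e j v] e(2) that by simp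
    have ro': "cdot (e j) r = 0" if "j < m" for j
      using ro[OF that] by (metis cnj_cdot complex_cnj_zero)
    define e' where "e' = e(m := complex_of_real (1 / norm r) *s r)"
    have "cdot (complex_of_real (1 / norm r) *s r) (complex_of_real (1 / norm r) *s r) = 1"
      using r0 cdot_self[of r] by (simp add: cdot_scale_left cdot_scale_right power2_eq_square)
    then have "orthonormal_family {..<Suc m} e'"
      using e(2) by (auto simp: orthonormal_family_def e'_def cdot_scale_left cdot_scale_right ro ro' less_Suc_eq)
    moreover have "\<forall>j<Suc m. e' j \<in> S"
      using e(1) rS S by (auto simp: e'_def less_Suc_eq vec.subspace_scale)
    ultimately have "Q (Suc m)" unfolding Q_def by blast
    then have "Suc m \<le> m" unfolding m_def using Greatest_le_nat[of Q] le by blast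
    then show False by simp
  qed
  have "m = vec.dim S"
    using orthonormal_family_card_eq[of "{..<m}" e S] e sp by simp
  with e sp that show ?thesis by blast
qed

section \<open>Real rank and complex span\<close>

text \<open>The real and imaginary parts of a complex relation between real vectors are real
  relations.\<close>

lemma cvec_independent:
  assumes "independent B"
  shows "vec.independent (cvec ` B)"
proof (rule vec.independent_if_scalars_zero)
  have fin: "finite B" using assms by (rule independent_imp_finite)
  then show "finite (cvec ` B)" by simp
  fix f x assume s: "(\<Sum>x\<in>cvec ` B. f x *s x) = 0" and "x \<in> cvec ` B"
  then obtain b where b: "b \<in> B" "x = cvec b" by blast
  have s': "(\<Sum>b\<in>B. f (cvec b) *s cvec b) = 0"
    using s by (simp add: sum.reindex inj_on_def)
  have "(\<Sum>b\<in>B. Re (f (cvec b)) *\<^sub>R b) = Re_vec (\<Sum>b\<in>B. f (cvec b) *s cvec b)"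
    by (simp add: Re_vec_def cvec_def vec_eq_iff sum_component)
  then have "(\<Sum>b\<in>B. Re (f (cvec b)) *\<^sub>R b) = 0"
    by (simp add: s' Re_vec_def vec_eq_iff)
  moreover have "(\<Sum>b\<in>B. Im (f (cvec b)) *\<^sub>R b) = Im_vec (\<Sum>b\<in>B. f (cvec b) *s cvec b)"
    by (simp add: Im_vec_def cvec_def vec_eq_iff sum_component)
  then have "(\<Sum>b\<in>B. Im (f (cvec b)) *\<^sub>R b) = 0"
    by (simp add: s' Im_vec_def vec_eq_iff)
  ultimately have "Re (f (cvec b)) = 0" "Im (f (cvec b)) = 0"
    using independentD[OF assms fin order_refl _ b(1), of "\<lambda>b. Re (f (cvec b))"]
      independentD[OF assms fin order_refl _ b(1), of "\<lambda>b. Im (f (cvec b))"] by auto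
  then show "f x = 0" by (simp add: b complex_eq_iff)
qed

lemma cvec_span: "x \<in> span B \<Longrightarrow> cvec x \<in> vec.span (cvec ` B)"
proof (induction rule: span_induct_alt)
  case base
  then show ?case by (simp add: vec.span_zero)
next
  case (step c x y)
  then show ?case by (simp add: cvec_add cvec_scaleR vec.span_add vec.span_scale vec.span_base)
qed

text \<open>A real basis of the range of \<open>X\<close> spans the range of its complexification
  over the complex numbers, so the independent images of the \<open>e p\<close> are at most as many
  as that basis.\<close>

lemma card_le_rank:
  fixes X :: "real^'n^'n"
  assumes fin: "finite P"
    and bi: "\<And>p q. p \<in> P \<Longrightarrow> q \<in> P \<Longrightarrow> cdot (complexify X *v e p) (e q) = (if p = q then c else 0)"
    and c: "c \<noteq> 0"
  shows "card P \<le> rank X"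
proof -
  let ?g = "\<lambda>p. complexify X *v e p"
  obtain B where B: "B \<subseteq> range ((*v) X)" "independent B" "range ((*v) X) \<subseteq> span B"
    "card B = dim (range ((*v) X))"
    using basis_exists by blast
  have "?g p \<in> vec.span (cvec ` B)" for p
  proof -
    have "?g p = complexify X *v (cvec (Re_vec (e p)) + \<i> *s cvec (Im_vec (e p)))"
      by (simp flip: cvec_Re_Im)
    also have "\<dots> = cvec (X *v Re_vec (e p)) + \<i> *s cvec (X *v Im_vec (e p))"
      by (simp only: matrix_vector_right_distrib matrix_vector_scale complexify_cvec)
    also have "\<dots> \<in> vec.span (cvec ` B)"
      using B(3) by (intro vec.span_add vec.span_scale cvec_span) auto
    finally show ?thesis .
  qed
  moreover have "inj_on ?g P" "vec.independent (?g ` P)"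
    using biorthogonal_independent[of P ?g e c] fin bi c by auto
  ultimately have "card (?g ` P) \<le> card (cvec ` B)"
    using vec.independent_span_bound[of "cvec ` B" "?g ` P"] B(2) independent_imp_finite by blast
  moreover have "card (cvec ` B) \<le> card B"
    using B(2) by (intro card_image_le independent_imp_finite)
  ultimately show ?thesis
    using \<open>inj_on ?g P\<close> B(4) by (simp add: rank_dim_range card_image)
qed

text \<open>A real basis of the range stays independent over the complex numbers, so any complex
  spanning set bounds its size.\<close>

lemma rank_le_card:
  fixes X :: "real^'n^'n"
  assumes "finite V" "\<And>w. complexify X *v w \<in> vec.span V"
  shows "rank X \<le> card V"
proof -
  obtain B where B: "B \<subseteq> range ((*v) X)" "independent B"
    "card B = dim (range ((*v) X))"
    using basis_exists[of "range ((*v) X)"] by metis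
  have "cvec ` B \<subseteq> vec.span V"
  proof
    fix z assume "z \<in> cvec ` B"
    then obtain x where "z = cvec (X *v x)" using B(1) by blast
    then show "z \<in> vec.span V" using assms(2)[of "cvec x"] by (simp add: complexify_cvec)
  qed
  then have "card (cvec ` B) \<le> card V"
    using vec.independent_span_bound[OF assms(1) cvec_independent[OF B(2)]] by blast
  then show ?thesis using B(3) by (simp add: rank_dim_range card_image inj_on_def)
qed

subsection \<open>The matrix exponential\<close>

abbreviation mpow :: "'a::real_normed_field^'n^'n \<Rightarrow> nat \<Rightarrow> 'a^'n^'n" where
  "mpow M k \<equiv> ((\<lambda>N. M ** N) ^^ k) (mat 1)"

text \<open>The constant comes from summing over all entries; it is crude, but enough to compare the
  exponential series of a matrix with a scalar one.\<close>

lemma norm_matrix_mult_le: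
  fixes A B :: "'a::real_normed_field^'n^'n"
  shows "norm (A ** B) \<le> real CARD('n) ^ 3 * (norm A * norm B)"
proof -
  have entry: "norm (M $ i $ j) \<le> norm M" for M :: "'a^'n^'n" and i j
    using Finite_Cartesian_Product.norm_nth_le[of "M $ i" j] Finite_Cartesian_Product.norm_nth_le[of M i] by linarith
  have l1: "norm x \<le> (\<Sum>i\<in>UNIV. norm (x $ i))" for x :: "('b::real_normed_vector)^'n"
    by (simp add: norm_vec_def L2_set_le_sum)
  have "norm (A ** B) \<le> (\<Sum>i\<in>UNIV. norm ((A ** B) $ i))"
    by (rule l1)
  also have "\<dots> \<le> (\<Sum>i\<in>UNIV. \<Sum>j\<in>UNIV. norm ((A ** B) $ i $ j))"
    by (intro sum_mono l1)
  also have "\<dots> \<le> (\<Sum>i\<in>(UNIV::'n set). \<Sum>j\<in>(UNIV::'n set). \<Sum>k\<in>(UNIV::'n set). norm A * norm B)"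
  proof (intro sum_mono)
    fix i j
    have "norm ((A ** B) $ i $ j) \<le> (\<Sum>k\<in>UNIV. norm (A $ i $ k * B $ k $ j))"
      by (simp add: matrix_matrix_mult_def norm_sum)
    also have "\<dots> \<le> (\<Sum>k\<in>(UNIV::'n set). norm A * norm B)"
      by (intro sum_mono) (simp add: norm_mult mult_mono entry)
    finally show "norm ((A ** B) $ i $ j) \<le> (\<Sum>k\<in>(UNIV::'n set). norm A * norm B)" .
  qed
  also have "\<dots> = real CARD('n) ^ 3 * (norm A * norm B)"
    by (simp add: power3_eq_cube)
  finally show ?thesis .
qed

lemma summable_mat_exp:
  fixes M :: "'a::{real_normed_field,banach}^'n^'n"
  shows "summable (\<lambda>k. (1 / fact k :: real) *\<^sub>R mpow M k)"
proof -
  define K where "K = real CARD('n) ^ 3"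
  let ?c = "norm (mat 1 :: 'a^'n^'n)"
  have b: "norm (mpow M k) \<le> ?c * (K * norm M) ^ k" for k
  proof (induction k)
    case (Suc k)
    have "norm (mpow M (Suc k)) \<le> K * (norm M * norm (mpow M k))"
      using norm_matrix_mult_le[of M "mpow M k"] by (simp add: K_def)
    also have "\<dots> \<le> K * (norm M * (?c * (K * norm M) ^ k))"
      using Suc by (intro mult_left_mono) (auto simp: K_def)
    finally show ?case by (simp add: algebra_simps)
  qed simp
  have "summable (\<lambda>k. ?c * (inverse (fact k) * (K * norm M) ^ k))"
    by (intro summable_mult summable_exp)
  moreover have "norm ((1 / fact k :: real) *\<^sub>R mpow M k) \<le> ?c * (inverse (fact k) * (K * norm M) ^ k)" for k
    using b[of k] by (simp add: field_simps)
  ultimately show ?thesis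
    by (rule summable_comparison_test'[where N = 0])
qed

text \<open>On an eigenvector the series collapses to the scalar exponential series. The spectrum,
  inverse, transpose and continuity of the flow are later derived from this on an
  eigenbasis.\<close>

lemma mat_exp_eigenvector:
  fixes M :: "complex^'n^'n"
  assumes "M *v u = c *s u"
  shows "mat_exp M *v u = exp c *s u"
proof -
  have pow: "mpow M k *v u = c ^ k *s u" for k
    by (induction k) (simp_all add: assms matrix_vector_scale vec.scale_scale mult.commute flip: matrix_vector_mul_assoc)
  have "linear (\<lambda>N::complex^'n^'n. N *v u)"
    by (auto intro!: linearI simp: vec_eq_iff matrix_vector_mult_def scaleR_sum_right distrib_right sum.distrib)
  then have bl: "bounded_linear (\<lambda>N::complex^'n^'n. N *v u)"
    by (simp add: linear_conv_bounded_linear)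
  have "linear (\<lambda>z::complex. z *s u)"
    by (auto intro!: linearI simp: vec_eq_iff algebra_simps)
  then have bl': "bounded_linear (\<lambda>z::complex. z *s u)"
    by (simp add: linear_conv_bounded_linear)
  have "(\<lambda>k. (1 / fact k :: real) *\<^sub>R mpow M k *v u) sums (mat_exp M *v u)"
    unfolding mat_exp_def by (intro bounded_linear.sums[OF bl] summable_sums summable_mat_exp)
  moreover have "(1 / fact k :: real) *\<^sub>R mpow M k *v u = (c ^ k /\<^sub>R fact k) *s u" for k
    by (simp add: linear_scale[OF bounded_linear.linear[OF bl]] pow divide_inverse vec_eq_iff)
  ultimately have "(\<lambda>k. (c ^ k /\<^sub>R fact k) *s u) sums (mat_exp M *v u)"
    by simp
  moreover have "(\<lambda>k. (c ^ k /\<^sub>R fact k) *s u) sums (exp c *s u)"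
    by (intro bounded_linear.sums[OF bl'] exp_converges)
  ultimately show ?thesis by (rule sums_unique2)
qed

lemma complexify_mat_exp: "complexify (mat_exp M) = mat_exp (complexify M)"
proof -
  have pow: "complexify (mpow M k) = mpow (complexify M) k" for k
    by (induction k) (simp_all add: complexify_mult)
  have "linear (complexify :: real^'n^'n \<Rightarrow> complex^'n^'n)"
    by (auto intro!: linearI simp: complexify_def vec_eq_iff complex_eq_iff)
  then have bl: "bounded_linear (complexify :: real^'n^'n \<Rightarrow> complex^'n^'n)"
    by (simp add: linear_conv_bounded_linear)
  show ?thesis
    unfolding mat_exp_def
    by (subst bounded_linear.suminf[OF bl summable_mat_exp]) (simp add: complexify_scaleR pow)
qed

subsection \<open>Eigenspaces of skew-symmetric matrices\<close>

lemma cdot_minus_right: "cdot u (- v) = - cdot u v"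
  by (simp add: cdot_def sum_negf)

lemma scaleR_eq_scale: "r *\<^sub>R v = complex_of_real r *s v" for v :: "complex^'n"
  by (simp add: vec_eq_iff complex_eq_iff)

lemma scaleR_complex_matrix_vector: "(r *\<^sub>R M) *v v = complex_of_real r *s (M *v v)" for M :: "complex^'n^'m"
  by (simp add: matrix_vector_mult_def vec_eq_iff sum_distrib_left scaleR_conv_of_real[where 'a=complex] mult.assoc)

lemma eigspace_iff: "v \<in> eigspace A \<omega> \<longleftrightarrow> complexify A *v v = (\<i> * of_real \<omega>) *s v"
proof -
  have "mat c *v v = c *s v" for c :: complex
    by (simp add: matrix_vector_mult_def mat_def vec_eq_iff if_distrib[where f = "\<lambda>x. x * _"] cong: if_cong)
  then show ?thesis by (simp add: eigspace_def matrix_vector_mult_diff_rdistrib)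
qed

lemma subspace_eigspace: "vec.subspace (eigspace A \<omega>)"
  by (rule vec.subspaceI)
     (simp_all add: eigspace_iff matrix_vector_right_distrib matrix_vector_scale vec.scale_right_distrib
        vec.scale_scale mult.commute)

lemma cnjv_eigspace: "v \<in> eigspace A \<omega> \<Longrightarrow> cnjv v \<in> eigspace A (- \<omega>)"
  by (simp add: eigspace_iff cnjv_scale flip: cnjv_complexify)

lemma freqs_iff: "\<omega> \<in> freqs A \<longleftrightarrow> (\<exists>v \<in> eigspace A \<omega>. v \<noteq> 0)"
  using vec.subspace_0[OF subspace_eigspace[of A \<omega>]] by (auto simp: freqs_def)

lemma freqs_uminus: "\<omega> \<in> freqs A \<Longrightarrow> - \<omega> \<in> freqs A"
  by (metis cnjv_eigspace cnjv_eq_0 freqs_iff)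

text \<open>Conjugation is not complex linear, so the dimension is carried over by conjugating an
  orthonormal basis and its expansion formula.\<close>

lemma freq_mult_uminus: "freq_mult A (- \<omega>) = freq_mult A \<omega>"
proof -
  obtain e where e: "\<And>j. j < freq_mult A \<omega> \<Longrightarrow> e j \<in> eigspace A \<omega>"
    "orthonormal_family {..<freq_mult A \<omega>} e"
    "\<And>v. v \<in> eigspace A \<omega> \<Longrightarrow> v = (\<Sum>j<freq_mult A \<omega>. cdot v (e j) *s e j)"
    unfolding freq_mult_def using orthonormal_basis_exists[OF subspace_eigspace[of A \<omega>]] by blast
  have "card {..<freq_mult A \<omega>} = vec.dim (eigspace A (- \<omega>))"
  proof (rule orthonormal_family_card_eq[where e = "\<lambda>j. cnjv (e j)"])
    show "orthonormal_family {..<freq_mult A \<omega>} (\<lambda>j. cnjv (e j))"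
      using e(2) by (auto simp: orthonormal_family_def cdot_cnjv)
    fix v assume "v \<in> eigspace A (- \<omega>)"
    then have "cnjv v \<in> eigspace A \<omega>" using cnjv_eigspace by fastforce
    from arg_cong[OF e(3)[OF this], of cnjv] show "v = (\<Sum>j<freq_mult A \<omega>. cdot v (cnjv (e j)) *s cnjv (e j))"
      by (simp add: cnjv_sum cnjv_scale flip: cdot_cnjv)
  qed (use e(1) cnjv_eigspace[of _ A \<omega>] in auto)
  then show ?thesis by (simp add: freq_mult_def)
qed

text \<open>Frequency 0 is its own negative, so a basis compatible with conjugation must consist of
  real vectors there. They come from the real kernel of \<open>A\<close>.\<close>

lemma kernel_real_orthonormal_basis:
  fixes A :: "real^'n^'n"
  obtains k :: "nat \<Rightarrow> real^'n" where
    "\<And>j. j < freq_mult A 0 \<Longrightarrow> cvec (k j) \<in> eigspace A 0"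
    "orthonormal_family {..<freq_mult A 0} (\<lambda>j. cvec (k j))"
    "\<And>v. v \<in> eigspace A 0 \<Longrightarrow> v = (\<Sum>j<freq_mult A 0. cdot v (cvec (k j)) *s cvec (k j))"
proof -
  define K where "K = {x. A *v x = 0}"
  have "subspace K" unfolding K_def
    by (auto simp: subspace_def matrix_vector_right_distrib scalar_mult_eq_scaleR matrix_vector_mult_scaleR)
  then obtain B where B: "B \<subseteq> K" "pairwise orthogonal B" "\<And>x. x \<in> B \<Longrightarrow> norm x = 1"
    "independent B" "span B = K"
    using orthonormal_basis_subspace by metis
  have fin: "finite B" using B(4) by (rule independent_imp_finite)
  define m where "m = card B"
  obtain k where k: "bij_betw k {..<m} B"
    using ex_bij_betw_nat_finite[OF fin] by (auto simp: m_def atLeast0LessThan)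
  have kB: "k j \<in> B" if "j < m" for j using k that by (auto simp: bij_betw_def)
  have kk: "k i \<bullet> k j = (if i = j then 1 else 0)" if "i < m" "j < m" for i j
  proof (cases "i = j")
    case True then show ?thesis using B(3)[OF kB[OF that(1)]] by (simp add: norm_eq_1)
  next
    case False
    then have "k i \<noteq> k j" using k that by (auto simp: bij_betw_def inj_on_def)
    then show ?thesis using B(2) kB that False by (auto simp: pairwise_def orthogonal_def)
  qed
  have real_exp: "x = (\<Sum>j<m. (x \<bullet> k j) *\<^sub>R k j)" if x: "x \<in> K" for x
  proof -
    define r where "r = x - (\<Sum>j<m. (x \<bullet> k j) *\<^sub>R k j)"
    have "(\<Sum>j<m. (x \<bullet> k j) *\<^sub>R k j) \<in> span B"
      by (intro span_sum span_scale span_base kB) simp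
    then have "r \<in> span B" unfolding r_def using x B(5) by (intro span_diff) auto
    moreover have "orthogonal r b" if b: "b \<in> B" for b
    proof -
      obtain i where i: "i < m" "b = k i" using k b by (auto simp: bij_betw_def)
      have "(\<Sum>j<m. (x \<bullet> k j) * (k j \<bullet> k i)) = (\<Sum>j<m. (x \<bullet> k j) * (if j = i then 1 else 0))"
        using i by (intro sum.cong) (auto simp: kk)
      then show ?thesis
        using i by (simp add: r_def orthogonal_def inner_diff_left inner_sum_left if_distrib cong: if_cong)
    qed
    ultimately have "orthogonal r r" using orthogonal_to_span by metis
    then show ?thesis by (simp add: orthogonal_def r_def)
  qed
  have mem: "cvec (k j) \<in> eigspace A 0" if "j < m" for j
    using kB[OF that] B(1) by (auto simp: eigspace_iff complexify_cvec K_def)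
  have on: "orthonormal_family {..<m} (\<lambda>j. cvec (k j))"
    by (auto simp: orthonormal_family_def cdot_cvec kk)
  have exp: "v = (\<Sum>j<m. cdot v (cvec (k j)) *s cvec (k j))" if v: "v \<in> eigspace A 0" for v
  proof -
    \<comment> \<open>\<open>A\<close> is real, so the real and imaginary parts of a complex kernel
      vector both lie in the real kernel.\<close>
    have "cvec (A *v Re_vec v) + \<i> *s cvec (A *v Im_vec v) = complexify A *v (cvec (Re_vec v) + \<i> *s cvec (Im_vec v))"
      by (simp only: matrix_vector_right_distrib matrix_vector_scale complexify_cvec)
    also have "\<dots> = 0" using v by (simp add: eigspace_iff flip: cvec_Re_Im)
    finally have "A *v Re_vec v = 0 \<and> A *v Im_vec v = 0"
      by (simp add: vec_eq_iff cvec_def complex_eq_iff)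
    then have "Re_vec v \<in> K" "Im_vec v \<in> K" by (auto simp: K_def)
    then have r: "cvec (Re_vec v) = (\<Sum>j<m. cdot (cvec (Re_vec v)) (cvec (k j)) *s cvec (k j))"
      and i: "cvec (Im_vec v) = (\<Sum>j<m. cdot (cvec (Im_vec v)) (cvec (k j)) *s cvec (k j))"
      by (metis (no_types, lifting) cdot_cvec cvec_scaleR cvec_sum real_exp sum.cong)+
    have "v = cvec (Re_vec v) + \<i> *s cvec (Im_vec v)" by (rule cvec_Re_Im)
    also have "\<dots> = (\<Sum>j<m. cdot (cvec (Re_vec v) + \<i> *s cvec (Im_vec v)) (cvec (k j)) *s cvec (k j))"
      by (subst r, subst i)
         (simp add: cdot_add_left cdot_scale_left vec.scale_left_distrib sum.distrib vec.scale_sum_right vec.scale_scale)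
    finally show ?thesis by (simp flip: cvec_Re_Im)
  qed
  have "m = freq_mult A 0"
    using orthonormal_family_card_eq[of "{..<m}" "\<lambda>j. cvec (k j)" "eigspace A 0"] mem on exp
    by (simp add: freq_mult_def)
  with mem on exp that show ?thesis by blast
qed

text \<open>All reals are allowed as indices: where \<open>\<omega>\<close> is no frequency, the
  multiplicity is 0 and every vector is zero.\<close>

lemma conjugation_invariant_eigenbasis:
  fixes A :: "real^'n^'n"
  obtains u :: "real \<Rightarrow> nat \<Rightarrow> complex^'n" where
    "\<And>\<omega> j. u \<omega> j \<in> eigspace A \<omega>"
    "\<And>\<omega> j. j \<ge> freq_mult A \<omega> \<Longrightarrow> u \<omega> j = 0"
    "\<And>\<omega>. orthonormal_family {..<freq_mult A \<omega>} (u \<omega>)"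
    "\<And>\<omega> v. v \<in> eigspace A \<omega> \<Longrightarrow> v = (\<Sum>j<freq_mult A \<omega>. cdot v (u \<omega> j) *s u \<omega> j)"
    "\<And>\<omega> j. u (- \<omega>) j = cnjv (u \<omega> j)"
proof -
  have "\<exists>e. (\<forall>j<freq_mult A \<omega>. e j \<in> eigspace A \<omega>) \<and> orthonormal_family {..<freq_mult A \<omega>} e \<and>
    (\<forall>v\<in>eigspace A \<omega>. v = (\<Sum>j<freq_mult A \<omega>. cdot v (e j) *s e j))" for \<omega>
    unfolding freq_mult_def using orthonormal_basis_exists[OF subspace_eigspace[of A \<omega>]] by metis
  then obtain b where b: "\<And>\<omega> j. j < freq_mult A \<omega> \<Longrightarrow> b \<omega> j \<in> eigspace A \<omega>"
    "\<And>\<omega>. orthonormal_family {..<freq_mult A \<omega>} (b \<omega>)"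
    "\<And>\<omega> v. v \<in> eigspace A \<omega> \<Longrightarrow> v = (\<Sum>j<freq_mult A \<omega>. cdot v (b \<omega> j) *s b \<omega> j)"
    by metis
  obtain k :: "nat \<Rightarrow> real^'n" where k:
    "\<And>j. j < freq_mult A 0 \<Longrightarrow> cvec (k j) \<in> eigspace A 0"
    "orthonormal_family {..<freq_mult A 0} (\<lambda>j. cvec (k j))"
    "\<And>v. v \<in> eigspace A 0 \<Longrightarrow> v = (\<Sum>j<freq_mult A 0. cdot v (cvec (k j)) *s cvec (k j))"
    using kernel_real_orthonormal_basis[of A] by blast
  \<comment> \<open>Positive frequencies get arbitrary orthonormal bases, 0 gets real vectors, and
    negative frequencies get the conjugates of the bases already chosen.\<close>
  define u where "u \<omega> j = (if j \<ge> freq_mult A \<omega> then 0 else if \<omega> > 0 then b \<omega> j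
     else if \<omega> = 0 then cvec (k j) else cnjv (b (- \<omega>) j))" for \<omega> j
  have "u \<omega> j \<in> eigspace A \<omega>" for \<omega> j
    using b(1)[of j \<omega>] k(1)[of j] cnjv_eigspace[OF b(1)[of j "- \<omega>"]] vec.subspace_0[OF subspace_eigspace[of A \<omega>]]
    by (auto simp: u_def freq_mult_uminus)
  moreover have "orthonormal_family {..<freq_mult A \<omega>} (u \<omega>)" for \<omega>
    using b(2)[of \<omega>] b(2)[of "- \<omega>"] k(2)
    by (auto simp: u_def orthonormal_family_def cdot_cnjv freq_mult_uminus)
  moreover have "v = (\<Sum>j<freq_mult A \<omega>. cdot v (u \<omega> j) *s u \<omega> j)" if v: "v \<in> eigspace A \<omega>" for \<omega> v
  proof -
    consider "\<omega> > 0" | "\<omega> = 0" | "\<omega> < 0" by linarith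
    then show ?thesis
    proof cases
      case 1
      then show ?thesis using b(3)[OF v] by (simp add: u_def)
    next
      case 2
      then show ?thesis using k(3) v by (simp add: u_def)
    next
      case 3
      have "cnjv v = (\<Sum>j<freq_mult A (- \<omega>). cdot (cnjv v) (b (- \<omega>) j) *s b (- \<omega>) j)"
        by (rule b(3)[OF cnjv_eigspace[OF v]])
      then have "cnjv (cnjv v) = (\<Sum>j<freq_mult A (- \<omega>). cnj (cdot (cnjv v) (b (- \<omega>) j)) *s cnjv (b (- \<omega>) j))"
        by (metis (no_types, lifting) cnjv_scale cnjv_sum sum.cong)
      then show ?thesis
        using 3 by (simp add: u_def freq_mult_uminus flip: cdot_cnjv)
    qed
  qed
  moreover have "u (- \<omega>) j = cnjv (u \<omega> j)" for \<omega> j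
    by (auto simp: u_def freq_mult_uminus)
  moreover have "u \<omega> j = 0" if "j \<ge> freq_mult A \<omega>" for \<omega> j
    using that by (simp add: u_def)
  ultimately show ?thesis using that by blast
qed

locale skew_matrix =
  fixes A :: "real^'n^'n"
  assumes skew: "transpose A = - A"
begin

lemma cdot_skew: "cdot (complexify A *v u) v = - cdot u (complexify A *v v)"
proof -
  have "complexify (- A) *v v = - (complexify A *v v)"
    by (simp add: complexify_def vec_eq_iff matrix_vector_mult_def sum_negf)
  then show ?thesis
    by (simp add: cdot_complexify skew cdot_minus_right)
qed

lemma eigspaces_orthogonal:
  assumes "u \<in> eigspace A \<omega>" "v \<in> eigspace A \<nu>" "\<omega> \<noteq> \<nu>"
  shows "cdot u v = 0"
proof -
  have "\<i> * of_real \<omega> * cdot u v = \<i> * of_real \<nu> * cdot u v"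
    using cdot_skew[of u v] assms(1,2) by (simp add: eigspace_iff cdot_scale_left cdot_scale_right)
  then show ?thesis using assms(3) by auto
qed

text \<open>One eigenvector per frequency gives nonzero vectors that are orthogonal for the real
  inner product, hence independent and finite in number.\<close>

lemma finite_freqs: "finite (freqs A)"
proof -
  have "\<forall>\<omega>\<in>freqs A. \<exists>v. v \<in> eigspace A \<omega> \<and> v \<noteq> 0"
    by (auto simp: freqs_iff)
  then obtain v where v: "\<And>\<omega>. \<omega> \<in> freqs A \<Longrightarrow> v \<omega> \<in> eigspace A \<omega> \<and> v \<omega> \<noteq> 0"
    by metis
  have o: "v \<omega> \<bullet> v \<nu> = 0" if "\<omega> \<in> freqs A" "\<nu> \<in> freqs A" "\<omega> \<noteq> \<nu>" for \<omega> \<nu>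
    using eigspaces_orthogonal v that by (metis inner_eq_Re_cdot zero_complex.simps(1))
  have "inj_on v (freqs A)"
    by (rule inj_onI) (metis o v inner_eq_zero_iff)
  moreover have "independent (v ` freqs A)"
    using o v by (intro pairwise_orthogonal_independent) (auto simp: pairwise_def orthogonal_def)
  then have "finite (v ` freqs A)" by (rule independent_imp_finite)
  ultimately show ?thesis by (rule finite_imageD[rotated])
qed

end

text \<open>
  Padding the bases with zeros beyond the multiplicity makes sums over several eigenspaces with a common
  index \<open>j\<close> meaningful even when their dimensions differ.
\<close>

locale skew_eigenbasis = skew_matrix +
  fixes u :: "real \<Rightarrow> nat \<Rightarrow> complex^'n"
  assumes u_mem: "u \<omega> j \<in> eigspace A \<omega>"
    and u_zero: "j \<ge> freq_mult A \<omega> \<Longrightarrow> u \<omega> j = 0"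
    and u_on: "orthonormal_family {..<freq_mult A \<omega>} (u \<omega>)"
    and u_exp: "v \<in> eigspace A \<omega> \<Longrightarrow> v = (\<Sum>j<freq_mult A \<omega>. cdot v (u \<omega> j) *s u \<omega> j)"
    and u_cnj: "u (- \<omega>) j = cnjv (u \<omega> j)"
begin

definition modes :: "(real \<times> nat) set" where
  "modes = (SIGMA \<omega>:freqs A. {..<freq_mult A \<omega>})"

abbreviation w :: "real \<times> nat \<Rightarrow> complex^'n" where "w p \<equiv> u (fst p) (snd p)"

lemma finite_modes: "finite modes"
  by (simp add: modes_def finite_freqs)

lemma cdot_u: "cdot (u \<omega> j) (u \<nu> l) = (if \<omega> = \<nu> \<and> j = l \<and> j < freq_mult A \<omega> then 1 else 0)"
proof (cases "\<omega> = \<nu>")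
  case True
  then show ?thesis
    using u_on[of \<omega>] u_zero[of \<omega> j] u_zero[of \<omega> l]
    by (cases "j < freq_mult A \<omega>"; cases "l < freq_mult A \<omega>") (auto simp: orthonormal_family_def)
qed (simp add: eigspaces_orthogonal[OF u_mem u_mem])

lemma orthonormal_modes: "orthonormal_family modes w"
  by (auto simp: orthonormal_family_def modes_def cdot_u)

text \<open>This is the spectral theorem for \<open>A\<close>. The complement \<open>W\<close> of
  all modes is invariant; if nonzero, it would contain an eigenvector of \<open>A\<close>, whose
  expansion in its own eigenspace vanishes.\<close>

lemma eigenbasis_expansion: "v = (\<Sum>p\<in>modes. cdot v (w p) *s w p)"
proof (rule ccontr)
  define r where "r v = v - (\<Sum>p\<in>modes. cdot v (w p) *s w p)" for v
  assume "v \<noteq> (\<Sum>p\<in>modes. cdot v (w p) *s w p)"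
  then have r0: "r v \<noteq> 0" by (simp add: r_def)
  define W where "W = {x. \<forall>p\<in>modes. cdot x (w p) = 0}"
  \<comment> \<open>The factor \<open>- \<i>\<close> makes the skew map self-adjoint for the real
    inner product; a real eigenvalue \<open>l\<close> of \<open>f\<close> is then a frequency of
    \<open>A\<close>.\<close>
  define f where "f x = (- \<i>) *s (complexify A *v x)" for x :: "complex^'n"
  have "linear f"
    unfolding f_def
    by (auto intro!: linearI simp: matrix_vector_right_distrib vec.scale_right_distrib scaleR_eq_scale
        matrix_vector_scale vec.scale_scale mult.commute simp del: vec.scale_minus_left)
  moreover have "f x \<bullet> y = x \<bullet> f y" for x y
    unfolding f_def inner_eq_Re_cdot cdot_scale_left cdot_scale_right cdot_skew by simp
  moreover have "subspace W"
    by (auto simp: subspace_def W_def cdot_add_left scaleR_eq_scale cdot_scale_left)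
  moreover have "r v \<in> W"
    using orthonormal_residual[OF finite_modes orthonormal_modes] by (simp add: W_def r_def)
  then have "W \<noteq> {0}" using r0 by blast
  moreover have "f x \<in> W" if "x \<in> W" for x
  proof -
    have "cdot (f x) (w p) = 0" if "p \<in> modes" for p
      unfolding f_def cdot_scale_left cdot_skew
      using \<open>x \<in> W\<close> that u_mem[of "fst p" "snd p"] by (auto simp: W_def eigspace_iff cdot_scale_right)
    then show ?thesis by (simp add: W_def)
  qed
  ultimately obtain x l where x: "x \<in> W" "norm x = 1" "f x = l *\<^sub>R x"
    by (rule selfadjoint_min_eigenvector)
  have "\<i> *s f x = complexify A *v x" by (simp add: f_def vec.scale_scale)
  then have "complexify A *v x = (\<i> * of_real l) *s x"
    using x(3) by (metis scaleR_eq_scale vec.scale_scale)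
  then have xE: "x \<in> eigspace A l" by (simp add: eigspace_iff)
  moreover have "x \<noteq> 0" using x(2) by auto
  ultimately have "l \<in> freqs A" by (auto simp: freqs_iff)
  then have "cdot x (u l j) = 0" if "j < freq_mult A l" for j
    using x(1) that by (auto simp: W_def modes_def)
  then have "x = 0" using u_exp[OF xE] by simp
  then show False using x(2) by simp
qed

lemma matrix_eq_modesI:
  fixes M N :: "complex^'n^'n"
  assumes "\<And>p. p \<in> modes \<Longrightarrow> M *v w p = N *v w p"
  shows "M = N"
proof -
  have "M *v v = N *v v" for v
    by (subst (1 2) eigenbasis_expansion[of v]) (simp add: matrix_vector_sum matrix_vector_scale assms)
  then show ?thesis by (simp add: matrix_eq)
qed

lemma card_modes: "card modes = CARD('n)"
proof -
  have "card modes = vec.dim (UNIV :: (complex^'n) set)"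
    using eigenbasis_expansion
    by (intro orthonormal_family_card_eq[OF finite_modes orthonormal_modes]) auto
  then show ?thesis by (simp add: vec.dim_UNIV vec.dimension_def card_cart_basis)
qed

lemma sum_freq_mult: "(\<Sum>\<omega>\<in>freqs A. freq_mult A \<omega>) = CARD('n)"
  using card_modes by (simp add: modes_def card_SigmaI finite_freqs)

definition U :: "real \<Rightarrow> real^'n^'n" where "U t = mat_exp (t *\<^sub>R A)"

lemma complexify_U: "v \<in> eigspace A \<omega> \<Longrightarrow> complexify (U t) *v v = exp (\<i> * of_real (\<omega> * t)) *s v"
proof -
  assume "v \<in> eigspace A \<omega>"
  then have "complexify (t *\<^sub>R A) *v v = (\<i> * of_real (\<omega> * t)) *s v"
    by (simp add: complexify_scaleR eigspace_iff scaleR_complex_matrix_vector vec.scale_scale mult_ac)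
  then show ?thesis
    unfolding U_def complexify_mat_exp by (rule mat_exp_eigenvector)
qed

text \<open>Eigenvectors of \<open>A\<close> give one inclusion. For the other, applying the
  exponential to an eigenvector for \<open>c\<close> multiplies each of its coefficients both by
  \<open>c\<close> and by the phase of the mode, so all coefficients vanish if \<open>c\<close> is
  no phase.\<close>

lemma phase_spectrum_eq: "phase_spectrum A T = phase T ` freqs A"
proof
  have U: "mat_exp (T *\<^sub>R complexify A) = complexify (U T)"
    by (simp add: U_def complexify_mat_exp complexify_scaleR)
  have eig: "complexify (U T) *v v = phase T \<omega> *s v" if "v \<in> eigspace A \<omega>" for v \<omega>
    using complexify_U[OF that] by (simp add: phase_def)
  show "phase T ` freqs A \<subseteq> phase_spectrum A T"
    unfolding phase_spectrum_def eigenvalues_def U using eig freqs_iff by blast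
  show "phase_spectrum A T \<subseteq> phase T ` freqs A"
  proof
    fix c assume "c \<in> phase_spectrum A T"
    then obtain v where v: "v \<noteq> 0" "complexify (U T) *v v = c *s v"
      by (auto simp: phase_spectrum_def eigenvalues_def U)
    show "c \<in> phase T ` freqs A"
    proof (rule ccontr)
      assume c: "c \<notin> phase T ` freqs A"
      have "cdot v (w q) = 0" if q: "q \<in> modes" for q
      proof -
        have "c * cdot v (w q) = cdot (complexify (U T) *v v) (w q)"
          by (simp add: v cdot_scale_left)
        also have "\<dots> = (\<Sum>p\<in>modes. cdot v (w p) * (phase T (fst p) * cdot (w p) (w q)))"
          by (subst eigenbasis_expansion[of v])
             (simp add: matrix_vector_sum matrix_vector_scale eig[OF u_mem] cdot_sum_left cdot_scale_left mult.assoc)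
        also have "\<dots> = (\<Sum>p\<in>modes. if p = q then cdot v (w p) * phase T (fst p) else 0)"
          using orthonormal_modes q by (intro sum.cong) (auto simp: orthonormal_family_def)
        also have "\<dots> = cdot v (w q) * phase T (fst q)"
          using q finite_modes by simp
        finally have "cdot v (w q) = 0 \<or> c = phase T (fst q)" by (simp add: mult.commute)
        moreover have "fst q \<in> freqs A" using q by (auto simp: modes_def)
        ultimately show ?thesis using c by blast
      qed
      then have "v = 0" using eigenbasis_expansion[of v] by simp
      then show False using v by simp
    qed
  qed
qed

end

subsection \<open>The Gramian\<close>

lemma continuous_on_matrix_mult:
  fixes f g :: "'b::topological_space \<Rightarrow> real^'n^'n"
  assumes "continuous_on S f" "continuous_on S g"
  shows "continuous_on S (\<lambda>t. f t ** g t)"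
  unfolding matrix_matrix_mult_def
  by (intro continuous_on_vec_lambda continuous_intros assms)

lemma linear_trace: "linear (trace :: real^'n^'n \<Rightarrow> real)"
  by (auto intro!: linearI simp: trace_def sum.distrib sum_distrib_left)

lemma linear_transpose: "linear (transpose :: real^'n^'m \<Rightarrow> real^'m^'n)"
  by (auto intro!: linearI simp: transpose_def vec_eq_iff)

lemma linear_cdot_complexify: "linear (\<lambda>M::real^'n^'n. cdot (complexify M *v a) b)"
proof (rule linearI)
  fix M N :: "real^'n^'n" and r :: real
  have "complexify (M + N) = complexify M + complexify N"
    by (simp add: complexify_def vec_eq_iff)
  then show "cdot (complexify (M + N) *v a) b = cdot (complexify M *v a) b + cdot (complexify N *v a) b"
    by (simp add: matrix_vector_mult_add_rdistrib cdot_add_left)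
  show "cdot (complexify (r *\<^sub>R M) *v a) b = r *\<^sub>R cdot (complexify M *v a) b"
    by (simp add: complexify_scaleR scaleR_complex_matrix_vector cdot_scale_left scaleR_conv_of_real[where 'a=complex])
qed

definition phase_integral :: "real \<Rightarrow> real \<Rightarrow> complex" where
  "phase_integral T \<delta> = integral {0..T} (\<lambda>t. exp (\<i> * of_real (\<delta> * t)))"

lemma phase_integral_0: "T > 0 \<Longrightarrow> phase_integral T 0 = of_real T"
  by (simp add: phase_integral_def scaleR_conv_of_real)

lemma phase_integral_nonzero:
  assumes "T > 0" "\<delta> \<noteq> 0"
  shows "phase_integral T \<delta> = (phase T \<delta> - 1) / (\<i> * of_real \<delta>)"
proof -
  have "((\<lambda>t. exp (\<i> * of_real (\<delta> * t))) has_integral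
      (exp (\<i> * of_real (\<delta> * T)) / (\<i> * of_real \<delta>) - exp (\<i> * of_real (\<delta> * 0)) / (\<i> * of_real \<delta>))) {0..T}"
  proof (rule fundamental_theorem_of_calculus)
    fix t assume "t \<in> {0..T}"
    \<comment> \<open>The antiderivative is differentiated in a complex variable and then restricted
      to the real line.\<close>
    have "((\<lambda>z. exp (\<i> * (of_real \<delta> * z)) / (\<i> * of_real \<delta>)) has_field_derivative
        exp (\<i> * (of_real \<delta> * of_real t))) (at (of_real t))"
      using assms(2) by (auto intro!: derivative_eq_intros) (simp add: mult_ac)
    then show "((\<lambda>t. exp (\<i> * of_real (\<delta> * t)) / (\<i> * of_real \<delta>)) has_vector_derivative
        exp (\<i> * of_real (\<delta> * t))) (at t within {0..T})"
      using has_vector_derivative_real_field[of "\<lambda>z. exp (\<i> * (of_real \<delta> * z)) / (\<i> * of_real \<delta>)"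
          "exp (\<i> * (of_real \<delta> * of_real t))" t "{0..T}"] by simp
  qed (use assms in auto)
  then show ?thesis
    unfolding phase_integral_def phase_def by (simp add: integral_unique diff_divide_distrib)
qed

lemma phase_eq_iff: "phase T \<omega> = phase T \<nu> \<longleftrightarrow> phase T (\<omega> - \<nu>) = 1"
  by (simp add: phase_def algebra_simps exp_diff)

text \<open>For equal frequencies the integral is the nonzero number \<open>T\<close>; otherwise the
  endpoint formula vanishes exactly when the phase of the difference is 1.\<close>

lemma phase_integral_diff_eq_0:
  assumes "T > 0"
  shows "phase_integral T (\<omega> - \<nu>) = 0 \<longleftrightarrow> \<omega> \<noteq> \<nu> \<and> phase T \<omega> = phase T \<nu>"
  using assms phase_integral_0[of T] phase_integral_nonzero[of T "\<omega> - \<nu>"]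
  by (cases "\<omega> = \<nu>") (auto simp: phase_eq_iff[of T \<omega>])

context skew_eigenbasis
begin

lemma U_inverse: "U t ** U (- t) = mat 1"
proof -
  have "complexify (U t ** U (- t)) = complexify (mat 1)"
  proof (rule matrix_eq_modesI)
    fix p
    show "complexify (U t ** U (- t)) *v w p = complexify (mat 1) *v w p"
      by (simp add: complexify_mult complexify_U[OF u_mem] matrix_vector_scale vec.scale_scale
          flip: matrix_vector_mul_assoc exp_add)
  qed
  then show ?thesis by (simp only: complexify_eq_iff)
qed

text \<open>Moving the transpose across \<open>cdot\<close> puts the eigenvalue into the
  conjugate-linear slot, which reverses the sign of \<open>t\<close>.\<close>

lemma transpose_U: "transpose (U t) = U (- t)"
proof -
  have "complexify (transpose (U t)) = complexify (U (- t))"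
  proof (rule matrix_eq_modesI)
    fix q assume q: "q \<in> modes"
    let ?z = "complexify (transpose (U t)) *v w q"
    have c: "cdot ?z (w p) = (if p = q then exp (\<i> * of_real (fst q * (- t))) else 0)" if "p \<in> modes" for p
    proof -
      have "cdot ?z (w p) = cdot (w q) (complexify (U t) *v w p)"
        by (simp add: cdot_complexify)
      also have "\<dots> = exp (\<i> * of_real (fst p * (- t))) * cdot (w q) (w p)"
        by (simp add: complexify_U[OF u_mem] cdot_scale_right exp_cnj)
      finally show ?thesis using that q orthonormal_modes by (auto simp: orthonormal_family_def)
    qed
    have "?z = (\<Sum>p\<in>modes. cdot ?z (w p) *s w p)" by (rule eigenbasis_expansion)
    also have "\<dots> = (\<Sum>p\<in>modes. if p = q then exp (\<i> * of_real (fst q * (- t))) *s w p else 0)"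
      by (intro sum.cong) (auto simp: c)
    also have "\<dots> = complexify (U (- t)) *v w q"
      using q finite_modes by (simp add: complexify_U[OF u_mem])
    finally show "?z = complexify (U (- t)) *v w q" .
  qed
  then show ?thesis by simp
qed

text \<open>In the eigenbasis every entry is a finite trigonometric sum in \<open>t\<close>.\<close>

lemma continuous_on_U: "continuous_on S U"
proof -
  have e: "U t $ i $ j = Re ((\<Sum>p\<in>modes. (cdot (axis j 1) (w p) * exp (\<i> * of_real (fst p * t))) *s w p) $ i)" for t i j
  proof -
    have "complexify (U t) *v axis j 1 = (\<Sum>p\<in>modes. (cdot (axis j 1) (w p) * exp (\<i> * of_real (fst p * t))) *s w p)"
      by (subst eigenbasis_expansion[of "axis j 1"])
         (simp add: matrix_vector_sum matrix_vector_scale complexify_U[OF u_mem] vec.scale_scale)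
    moreover have "(complexify (U t) *v axis j 1) $ i = of_real (U t $ i $ j)"
      by (simp add: matrix_vector_mult_def axis_def complexify_def if_distrib[where f = "\<lambda>x. _ * x"] cong: if_cong)
    ultimately show ?thesis by (metis Re_complex_of_real)
  qed
  have "continuous_on S (\<lambda>t. \<chi> i j. U t $ i $ j)"
    unfolding e sum_component vector_smult_component
    by (intro continuous_on_vec_lambda continuous_intros)
  then show ?thesis by simp
qed

lemma gramian_eq: "gramian A T X = integral {0..T} (\<lambda>t. U t ** X ** U (- t))"
  by (simp add: gramian_def U_def skew)

lemma gramian_integrable: "(\<lambda>t. U t ** X ** U (- t)) integrable_on {0..T}"
proof -
  have "continuous_on {0..T} (\<lambda>t. U (- t))"
    by (rule continuous_on_compose2[OF continuous_on_U[of UNIV]]) (auto intro!: continuous_intros)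
  then show ?thesis
    by (intro integrable_continuous_interval continuous_on_matrix_mult continuous_on_U continuous_on_const)
qed

text \<open>Trace, transpose and the entries in the eigenbasis are all computed by moving them under
  the integral.\<close>

lemma linear_gramian:
  assumes "linear L"
  shows "L (gramian A T X) = integral {0..T} (\<lambda>t. L (U t ** X ** U (- t)))"
  using integral_linear[OF gramian_integrable[of X T], of L] assms
  by (simp add: gramian_eq linear_conv_bounded_linear o_def)

lemma trace_gramian: "T > 0 \<Longrightarrow> trace (gramian A T X) = T * trace X"
proof -
  assume "T > 0"
  have "trace (U t ** X ** U (- t)) = trace X" for t
    using trace_mul_sym[of "U t" "X ** U (- t)"] U_inverse[of "- t"]
    by (simp flip: matrix_mul_assoc)
  then show ?thesis using \<open>T > 0\<close> by (simp add: linear_gramian[OF linear_trace])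
qed

lemma transpose_gramian: "transpose X = X \<Longrightarrow> transpose (gramian A T X) = gramian A T X"
  by (simp add: linear_gramian[OF linear_transpose] matrix_transpose_mul transpose_U matrix_mul_assoc)
     (simp add: gramian_eq)

lemma gramian_linear: "linear (gramian A T)"
proof (rule linearI)
  fix X Y :: "real^'n^'n" and r :: real
  have "U t ** (X + Y) ** U (- t) = U t ** X ** U (- t) + U t ** Y ** U (- t)" for t
    by (simp add: matrix_matrix_mult_def vec_eq_iff distrib_left distrib_right sum.distrib)
  then show "gramian A T (X + Y) = gramian A T X + gramian A T Y"
    by (simp add: gramian_eq integral_add gramian_integrable)
  have "U t ** (r *\<^sub>R X) ** U (- t) = r *\<^sub>R (U t ** X ** U (- t))" for t
    by (simp add: matrix_matrix_mult_def vec_eq_iff sum_distrib_left sum_distrib_right mult_ac)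
  then show "gramian A T (r *\<^sub>R X) = r *\<^sub>R gramian A T X"
    by (simp add: gramian_eq)
qed

lemma cdot_gramian:
  assumes a: "a \<in> eigspace A \<nu>" and b: "b \<in> eigspace A \<omega>"
  shows "cdot (complexify (gramian A T X) *v a) b = phase_integral T (\<omega> - \<nu>) * cdot (complexify X *v a) b"
proof -
  have "cdot (complexify (U t ** X ** U (- t)) *v a) b = exp (\<i> * of_real ((\<omega> - \<nu>) * t)) * cdot (complexify X *v a) b" for t
  proof -
    have "cdot (complexify (U t ** X ** U (- t)) *v a) b
        = cdot (complexify (U t) *v (complexify X *v (complexify (U (- t)) *v a))) b"
      by (simp add: complexify_mult matrix_vector_mul_assoc matrix_mul_assoc)
    \<comment> \<open>The outer factor passes to \<open>b\<close> as its transpose. There it acts by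
      a scalar, which the second slot conjugates, so the two exponentials combine to the frequency
      difference.\<close>
    also have "\<dots> = cdot (complexify X *v (complexify (U (- t)) *v a)) (complexify (U (- t)) *v b)"
      by (subst cdot_complexify) (simp add: transpose_U)
    also have "\<dots> = exp (\<i> * of_real (\<nu> * (- t))) * exp (\<i> * of_real (\<omega> * t)) * cdot (complexify X *v a) b"
      unfolding complexify_U[OF a] complexify_U[OF b]
      by (simp add: matrix_vector_scale cdot_scale_left cdot_scale_right exp_cnj)
    also have "exp (\<i> * of_real (\<nu> * (- t))) * exp (\<i> * of_real (\<omega> * t)) = exp (\<i> * of_real ((\<omega> - \<nu>) * t))"
      by (simp add: algebra_simps flip: exp_add)
    finally show ?thesis .
  qed
  then show ?thesis
    by (simp add: linear_gramian[OF linear_cdot_complexify] phase_integral_def)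
qed

text \<open>Both matrices are compared entrywise in the eigenbasis. Where
  \<open>phase_integral\<close> vanishes, the corresponding entry of \<open>X\<close> is
  unconstrained.\<close>

lemma gramian_scalar_iff:
  "gramian A T X = c *\<^sub>R mat 1 \<longleftrightarrow>
    (\<forall>p\<in>modes. \<forall>q\<in>modes. phase_integral T (fst q - fst p) * cdot (complexify X *v w p) (w q) =
       (if p = q then of_real c else 0))"
  (is "?L \<longleftrightarrow> ?R")
proof
  have cm: "complexify (c *\<^sub>R mat 1) *v v = of_real c *s v" for v :: "complex^'n"
    by (simp add: complexify_scaleR scaleR_complex_matrix_vector)
  show ?R if ?L
  proof (intro ballI)
    fix p q assume pq: "p \<in> modes" "q \<in> modes"
    have "phase_integral T (fst q - fst p) * cdot (complexify X *v w p) (w q) = of_real c * cdot (w p) (w q)"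
      using cdot_gramian[OF u_mem[of "fst p" "snd p"] u_mem[of "fst q" "snd q"], of T X] that
      by (simp add: cm cdot_scale_left)
    then show "phase_integral T (fst q - fst p) * cdot (complexify X *v w p) (w q) = (if p = q then of_real c else 0)"
      using orthonormal_modes pq by (auto simp: orthonormal_family_def)
  qed
  show ?L if R: ?R
  proof -
    have "complexify (gramian A T X) = complexify (c *\<^sub>R mat 1)"
    proof (rule matrix_eq_modesI)
      fix p assume p: "p \<in> modes"
      let ?z = "complexify (gramian A T X) *v w p"
      have "?z = (\<Sum>q\<in>modes. cdot ?z (w q) *s w q)" by (rule eigenbasis_expansion)
      also have "\<dots> = (\<Sum>q\<in>modes. if q = p then of_real c *s w q else 0)"
        using R p by (intro sum.cong) (auto simp: cdot_gramian[OF u_mem u_mem])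
      also have "\<dots> = complexify (c *\<^sub>R mat 1) *v w p"
        using p finite_modes by (simp add: cm)
      finally show "?z = complexify (c *\<^sub>R mat 1) *v w p" .
    qed
    then show ?thesis by simp
  qed
qed

end

subsection \<open>Smallest eigenvalue and attainment of the maximum\<close>

lemma symmetric_inner: "transpose M = M \<Longrightarrow> (M *v x) \<bullet> y = x \<bullet> (M *v y)" for M :: "real^'n^'n"
  by (metis dot_lmul_matrix transpose_matrix_vector)

text \<open>\<open>lambda_min\<close> is a \<open>Min\<close>, so it is meaningful only for a finite
  spectrum. Eigenvectors of distinct eigenvalues are orthogonal, hence independent.\<close>

lemma finite_eigenvalues_symmetric:
  fixes M :: "real^'n^'n"
  assumes M: "transpose M = M"
  shows "finite (eigenvalues M)"
proof -
  have "\<forall>c\<in>eigenvalues M. \<exists>v. v \<noteq> 0 \<and> M *v v = c *\<^sub>R v"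
    by (auto simp: eigenvalues_def scalar_mult_eq_scaleR)
  then obtain v where v: "\<And>c. c \<in> eigenvalues M \<Longrightarrow> v c \<noteq> 0 \<and> M *v v c = c *\<^sub>R v c"
    by metis
  have o: "v c \<bullet> v d = 0" if "c \<in> eigenvalues M" "d \<in> eigenvalues M" "c \<noteq> d" for c d
    using symmetric_inner[OF M, of "v c" "v d"] v[OF that(1)] v[OF that(2)] that(3) by simp
  have "inj_on v (eigenvalues M)"
    by (rule inj_onI) (metis o v inner_eq_zero_iff)
  moreover have "independent (v ` eigenvalues M)"
    using o v by (intro pairwise_orthogonal_independent) (auto simp: pairwise_def orthogonal_def)
  then have "finite (v ` eigenvalues M)" by (rule independent_imp_finite)
  ultimately show ?thesis by (rule finite_imageD[rotated])
qed

text \<open>The minimum of the Rayleigh quotient is itself an eigenvalue and bounds every eigenvalue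
  from below, so it is the \<open>Min\<close> of the spectrum.\<close>

lemma
  fixes M :: "real^'n^'n"
  assumes M: "transpose M = M"
  shows lambda_min_le: "lambda_min M * (v \<bullet> v) \<le> v \<bullet> (M *v v)"
    and lambda_min_eigenvector: "\<exists>x. norm x = 1 \<and> M *v x = lambda_min M *\<^sub>R x"
proof -
  obtain x l where x: "norm x = 1" "M *v x = l *\<^sub>R x" and min: "\<And>y. l * (y \<bullet> y) \<le> y \<bullet> (M *v y)"
  proof (rule selfadjoint_min_eigenvector[of "(*v) M" UNIV])
    show "(UNIV :: (real^'n) set) \<noteq> {0}"
      by (metis UNIV_I axis_eq_0_iff singletonD zero_neq_one)
  qed (auto simp: symmetric_inner[OF M])
  have "l \<in> eigenvalues M"
    using x by (auto simp: eigenvalues_def scalar_mult_eq_scaleR intro!: exI[of _ x])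
  moreover have "l \<le> c" if c: "c \<in> eigenvalues M" for c
  proof -
    obtain v where v: "v \<noteq> 0" "M *v v = c *\<^sub>R v"
      using c by (auto simp: eigenvalues_def scalar_mult_eq_scaleR)
    then have "l * (v \<bullet> v) \<le> c * (v \<bullet> v)" using min[of v] by simp
    then show ?thesis using v(1) by simp
  qed
  ultimately have "lambda_min M = l"
    unfolding lambda_min_def by (intro Min_eqI finite_eigenvalues_symmetric[OF M]) auto
  then show "lambda_min M * (v \<bullet> v) \<le> v \<bullet> (M *v v)" "\<exists>x. norm x = 1 \<and> M *v x = lambda_min M *\<^sub>R x"
    using min x by auto
qed

lemma axis_quadratic_form: "axis i 1 \<bullet> (M *v axis j 1) = M $ i $ j" for M :: "real^'n^'n"
  by (simp add: matrix_vector_mult_basis column_def inner_axis')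

lemma lambda_min_scalar: "lambda_min (c *\<^sub>R mat 1 :: real^'n^'n) = c"
proof -
  have s: "transpose (c *\<^sub>R mat 1 :: real^'n^'n) = c *\<^sub>R mat 1"
    by (simp add: transpose_def mat_def vec_eq_iff)
  obtain x :: "real^'n" where x: "norm x = 1"
    "(c *\<^sub>R mat 1) *v x = lambda_min (c *\<^sub>R mat 1 :: real^'n^'n) *\<^sub>R x"
    using lambda_min_eigenvector[OF s] by blast
  moreover have "(c *\<^sub>R mat 1) *v x = c *\<^sub>R x" by (simp flip: scaleR_matrix_vector_assoc)
  ultimately show ?thesis by auto
qed

lemma lambda_min_le_trace:
  fixes M :: "real^'n^'n"
  assumes M: "transpose M = M"
  shows "lambda_min M \<le> trace M / CARD('n)"
proof -
  have "(\<Sum>i\<in>(UNIV::'n set). lambda_min M) \<le> trace M"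
    unfolding trace_def
    using lambda_min_le[OF M, of "axis _ 1"] by (intro sum_mono) (simp add: axis_quadratic_form)
  then show ?thesis by (simp add: field_simps)
qed

text \<open>In the equality case every diagonal entry equals \<open>l\<close>, so the nonnegative
  form of \<open>f\<close> has a zero at each axis vector, and \<open>nonneg_form_zero\<close> makes
  \<open>f\<close> vanish on the standard basis.\<close>

lemma lambda_min_eq_trace:
  fixes M :: "real^'n^'n"
  assumes M: "transpose M = M" and eq: "lambda_min M = trace M / CARD('n)"
  shows "M = lambda_min M *\<^sub>R mat 1"
proof -
  define l where "l = lambda_min M"
  define f where "f x = M *v x - l *\<^sub>R x" for x
  have lin: "linear f" unfolding f_def by (intro linear_compose_sub matrix_vector_mul_linear linear_scale_self)
  have sa: "f x \<bullet> y = x \<bullet> f y" for x y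
    by (simp add: f_def inner_diff_left inner_diff_right symmetric_inner[OF M])
  have nn: "0 \<le> y \<bullet> f y" for y
    using lambda_min_le[OF M, of y] by (simp add: f_def inner_diff_right l_def)
  have ax: "axis i 1 \<bullet> f (axis i 1) = M $ i $ i - l" for i
    by (simp add: f_def inner_diff_right axis_quadratic_form)
  have "(\<Sum>i\<in>UNIV. M $ i $ i - l) = 0"
    using eq by (simp add: sum_subtractf trace_def l_def)
  moreover have "0 \<le> M $ i $ i - l" for i using nn[of "axis i 1"] by (simp add: ax)
  ultimately have "M $ i $ i - l = 0" for i
    by (simp add: sum_nonneg_eq_0_iff)
  then have "f (axis i 1) \<bullet> f (axis i 1) = 0" for i
    using nonneg_form_zero[OF lin sa subspace_UNIV nn, of "axis i 1"] by (simp add: ax)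
  then have "M *v axis i 1 = l *\<^sub>R axis i 1" for i
    by (simp add: f_def)
  then have "M $ i $ j = l * (if i = j then 1 else 0)" for i j
    using axis_quadratic_form[of i M j] by (auto simp: inner_axis_axis)
  then show ?thesis by (simp add: vec_eq_iff mat_def l_def)
qed

lemma norm_matrix_vector_le: "norm (D *v x) \<le> norm D * norm x" for D :: "real^'n^'m"
proof -
  have "norm (D *v x) \<le> L2_set (\<lambda>i. norm (D $ i) * norm x) UNIV"
    unfolding norm_vec_def[of "D *v x"]
    by (intro L2_set_mono) (auto simp: matrix_vector_mul_component Cauchy_Schwarz_ineq2)
  also have "\<dots> = norm D * norm x"
    by (simp add: norm_vec_def[of D] L2_set_left_distrib)
  finally show ?thesis .
qed

text \<open>A unit eigenvector of \<open>N\<close> for its least eigenvalue serves as test vector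
  for \<open>M\<close>. Exchanging the matrices makes \<open>lambda_min\<close> Lipschitz with
  constant 1.\<close>

lemma lambda_min_diff_le:
  fixes M N :: "real^'n^'n"
  assumes "transpose M = M" "transpose N = N"
  shows "lambda_min M - lambda_min N \<le> norm (M - N)"
proof -
  obtain x where x: "norm x = 1" "N *v x = lambda_min N *\<^sub>R x"
    using lambda_min_eigenvector[OF assms(2)] by blast
  then have xx: "x \<bullet> x = 1" by (simp add: norm_eq_1)
  have "lambda_min M \<le> x \<bullet> (M *v x)" using lambda_min_le[OF assms(1), of x] xx by simp
  also have "\<dots> = x \<bullet> (N *v x) + x \<bullet> ((M - N) *v x)"
    by (simp add: matrix_vector_mult_diff_rdistrib inner_diff_right)
  also have "\<dots> \<le> lambda_min N + norm (M - N)"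
    using norm_cauchy_schwarz[of x "(M - N) *v x"] norm_matrix_vector_le[of "M - N" x] x xx by simp
  finally show ?thesis by simp
qed

lemma continuous_on_lambda_min: "continuous_on {M :: real^'n^'n. transpose M = M} lambda_min"
proof (rule continuous_onI)
  fix M :: "real^'n^'n" and e :: real
  assume M: "M \<in> {M. transpose M = M}" "e > 0"
  have "dist (lambda_min N) (lambda_min M) \<le> dist N M" if "transpose N = N" for N
    using lambda_min_diff_le[of M N] lambda_min_diff_le[of N M] M that
    by (simp add: dist_norm norm_minus_commute abs_le_iff)
  then show "\<exists>d>0. \<forall>N\<in>{M. transpose M = M}. dist N M < d \<longrightarrow> dist (lambda_min N) (lambda_min M) \<le> e"
    using M(2) by (intro exI[of _ e]) force
qed

section \<open>Compactness of the feasible set\<close>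

text \<open>Rank cannot drop under small perturbations: on its row space \<open>V\<close>,
  \<open>X0\<close> stretches by at least a factor \<open>e > 0\<close>, and any matrix closer than
  \<open>e\<close> is still injective on \<open>V\<close>.\<close>

lemma closed_rank_le: "closed {X :: real^'n^'m. rank X \<le> k}"
proof -
  have "open {X :: real^'n^'m. k < rank X}"
  proof (subst open_dist, intro ballI)
    fix X0 :: "real^'n^'m" assume X0: "X0 \<in> {X. k < rank X}"
    define V where "V = span (rows X0)"
    have inj: "inj_on ((*v) X0) V"
      unfolding V_def by (auto intro!: inj_onI dest: matrix_vector_mul_injective_on_rowspace)
    have "\<forall>x\<in>V. X0 *v x = 0 \<longrightarrow> x = 0"
      using inj inj_onD[OF inj, of _ 0] by (simp add: V_def span_zero)
    then obtain e where e: "e > 0" "\<And>x. x \<in> V \<Longrightarrow> norm (X0 *v x) \<ge> e * norm x"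
      using injective_imp_isometric[of V "(*v) X0"] by (auto simp: V_def closed_subspace)
    show "\<exists>d>0. \<forall>X. dist X X0 < d \<longrightarrow> X \<in> {X. k < rank X}"
    proof (intro exI conjI allI impI)
      fix X assume d: "dist X X0 < e"
      have "x = 0" if x: "x \<in> V" "X *v x = 0" for x
      proof (rule ccontr)
        assume "x \<noteq> 0"
        have "e * norm x \<le> norm (X0 *v x)" using e x by simp
        also have "\<dots> = norm ((X - X0) *v x)" using x by (simp add: matrix_vector_mult_diff_rdistrib)
        also have "\<dots> \<le> norm (X - X0) * norm x" by (rule norm_matrix_vector_le)
        also have "\<dots> < e * norm x" using d \<open>x \<noteq> 0\<close> by (simp add: dist_norm)
        finally show False by simp
      qed
      then have "inj_on ((*v) X) V"
        unfolding V_def by (subst linear_injective_on_subspace_0) auto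
      then have "dim ((*v) X ` V) = dim V"
        by (intro dim_image_eq) (auto simp: V_def span_span)
      then have "rank X0 \<le> rank X"
        using dim_subset[of "(*v) X ` V" "range ((*v) X)"]
        by (auto simp: V_def row_rank_def[of X0] rank_dim_range[of X])
      then show "X \<in> {X. k < rank X}" using X0 by simp
    qed (rule e)
  qed
  moreover have "{X :: real^'n^'m. rank X \<le> k} = - {X. k < rank X}" by auto
  ultimately show ?thesis by (simp add: closed_def)
qed

definition state_matrices :: "nat \<Rightarrow> (real^'n^'n) set" where
  "state_matrices k = {X. psd X \<and> trace X = 1 \<and> rank X \<le> k}"

lemma psd_diag_nonneg: "psd X \<Longrightarrow> 0 \<le> X $ i $ i"
  by (metis axis_quadratic_form psd_def)

text \<open>The form is nonnegative at the sum and the difference of two axis vectors. Together with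
  the trace this bounds all entries.\<close>

lemma psd_entry_le:
  assumes "psd X"
  shows "2 * \<bar>X $ i $ j\<bar> \<le> X $ i $ i + X $ j $ j"
proof -
  have s: "X $ j $ i = X $ i $ j"
  proof -
    have "transpose X $ i $ j = X $ i $ j" using assms by (simp add: psd_def)
    then show ?thesis by (simp add: transpose_def)
  qed
  have "0 \<le> (axis i 1 + c *\<^sub>R axis j 1) \<bullet> (X *v (axis i 1 + c *\<^sub>R axis j 1))" for c
    using assms by (simp add: psd_def)
  then have "0 \<le> X $ i $ i + c * (2 * X $ i $ j) + c * c * X $ j $ j" for c
    by (simp add: matrix_vector_right_distrib matrix_vector_mult_scaleR inner_add_left inner_add_right
        axis_quadratic_form s algebra_simps)
  from this[of 1] this[of "-1"] show ?thesis by simp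
qed

lemma compact_state_matrices: "compact (state_matrices k :: (real^'n^'n) set)"
proof -
  have "bounded (state_matrices k :: (real^'n^'n) set)"
  proof (rule boundedI)
    fix X :: "real^'n^'n" assume X: "X \<in> state_matrices k"
    then have psd: "psd X" and tr: "trace X = 1" by (auto simp: state_matrices_def)
    have d: "X $ i $ i \<le> 1" for i
    proof -
      have "X $ i $ i \<le> trace X"
        unfolding trace_def by (intro member_le_sum) (auto simp: psd_diag_nonneg[OF psd])
      then show ?thesis using tr by simp
    qed
    have "norm X \<le> (\<Sum>i\<in>UNIV. norm (X $ i))" by (simp add: norm_vec_def L2_set_le_sum)
    also have "\<dots> \<le> (\<Sum>i\<in>UNIV. \<Sum>j\<in>UNIV. \<bar>X $ i $ j\<bar>)"
      by (intro sum_mono norm_le_l1_cart)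
    also have "\<dots> \<le> (\<Sum>i\<in>(UNIV::'n set). \<Sum>j\<in>(UNIV::'n set). 1)"
    proof (intro sum_mono)
      fix i j show "\<bar>X $ i $ j\<bar> \<le> 1" using psd_entry_le[OF psd, of i j] d[of i] d[of j] by linarith
    qed
    finally show "norm X \<le> (\<Sum>i\<in>(UNIV::'n set). \<Sum>j\<in>(UNIV::'n set). 1)" .
  qed
  moreover have "closed (state_matrices k :: (real^'n^'n) set)"
  proof -
    have tr: "continuous_on UNIV (transpose :: real^'n^'n \<Rightarrow> _)" "continuous_on UNIV (trace :: real^'n^'n \<Rightarrow> _)"
      by (auto intro!: linear_continuous_on simp: linear_transpose linear_trace simp flip: linear_conv_bounded_linear)
    have q: "continuous_on UNIV (\<lambda>X :: real^'n^'n. v \<bullet> (X *v v))" for v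
      unfolding inner_vec_def matrix_vector_mult_def by (simp, intro continuous_intros)
    have "closed ({X :: real^'n^'n. transpose X = X} \<inter> {X. \<forall>v. 0 \<le> v \<bullet> (X *v v)} \<inter> {X. trace X = 1} \<inter> {X. rank X \<le> k})"
      by (intro closed_Int closed_rank_le closed_Collect_eq closed_Collect_all closed_Collect_le tr q continuous_intros)
    also have "\<dots> = state_matrices k" by (auto simp: state_matrices_def psd_def)
    finally show ?thesis .
  qed
  ultimately show ?thesis by (simp add: compact_eq_bounded_closed)
qed

lemma state_matrices_nonempty: "k \<ge> 1 \<Longrightarrow> state_matrices k \<noteq> ({} :: (real^'n^'n) set)"
proof -
  assume k: "k \<ge> 1"
  obtain a :: 'n where True by blast
  \<comment> \<open>The projection onto one coordinate axis has rank and trace 1.\<close>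
  define X :: "real^'n^'n" where "X = (\<chi> i j. if i = a \<and> j = a then 1 else 0)"
  have Xv: "X *v v = (v $ a) *\<^sub>R axis a 1" for v
    by (auto simp: X_def matrix_vector_mult_def vec_eq_iff axis_def if_distrib[where f = "\<lambda>x. x * _"] cong: if_cong)
  have "psd X"
    by (auto simp: psd_def Xv inner_axis) (auto simp: X_def transpose_def vec_eq_iff)
  moreover have "trace X = 1" by (simp add: trace_def X_def)
  moreover have "rank X \<le> 1"
  proof -
    have "range ((*v) X) \<subseteq> span {axis a 1}"
      by (auto simp: Xv intro: span_scale span_base)
    then have "rank X \<le> card {axis a 1 :: real^'n}"
      unfolding rank_dim_range by (intro dim_le_card) auto
    then show ?thesis by simp
  qed
  ultimately show ?thesis using k by (auto simp: state_matrices_def)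
qed

context skew_eigenbasis
begin

text \<open>\<open>GREATEST\<close> is meaningful only for an attained maximum. Compactness and the
  continuity of \<open>lambda_min\<close> on symmetric matrices supply one, and
  \<open>k \<ge> 1\<close> makes the feasible set nonempty.\<close>

lemma
  assumes "k \<ge> 1"
  shows gamma_attained: "\<exists>X\<in>state_matrices k. gamma k A T = lambda_min (gramian A T X)"
    and gamma_upper: "X \<in> state_matrices k \<Longrightarrow> lambda_min (gramian A T X) \<le> gamma k A T"
proof -
  have "continuous_on (state_matrices k) (\<lambda>X. lambda_min (gramian A T X))"
  proof (rule continuous_on_compose2[OF continuous_on_lambda_min])
    show "continuous_on (state_matrices k) (gramian A T)"
      using gramian_linear by (simp add: linear_continuous_on linear_conv_bounded_linear)
  qed (auto simp: state_matrices_def psd_def transpose_gramian)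
  then obtain X where X: "X \<in> state_matrices k"
    and mx: "\<And>Y. Y \<in> state_matrices k \<Longrightarrow> lambda_min (gramian A T Y) \<le> lambda_min (gramian A T X)"
    using continuous_attains_sup[OF compact_state_matrices state_matrices_nonempty[OF assms]] by metis
  have "gamma k A T = lambda_min (gramian A T X)"
    unfolding gamma_def
    using X mx by (intro Greatest_equality) (auto simp: state_matrices_def)
  then show "\<exists>X\<in>state_matrices k. gamma k A T = lambda_min (gramian A T X)"
    and "X \<in> state_matrices k \<Longrightarrow> lambda_min (gramian A T X) \<le> gamma k A T" for X
    using X mx by auto
qed

end

subsection \<open>Minimal rank\<close>

lemma phase_uminus: "phase T (- \<omega>) = cnj (phase T \<omega>)"
  by (simp add: phase_def exp_cnj)

lemma freqs_at_cnj: "freqs_at A T (cnj \<zeta>) = uminus ` freqs_at A T \<zeta>"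
proof -
  have sub: "uminus ` freqs_at A T \<zeta> \<subseteq> freqs_at A T (cnj \<zeta>)" for \<zeta>
    by (auto simp: freqs_at_def phase_uminus freqs_uminus)
  \<comment> \<open>Negation is an involution, so the opposite inclusion is \<open>sub\<close> at
    \<open>cnj \<zeta>\<close>.\<close>
  have "freqs_at A T (cnj \<zeta>) = uminus ` uminus ` freqs_at A T (cnj \<zeta>)"
    by (simp add: image_image)
  also have "\<dots> \<subseteq> uminus ` freqs_at A T \<zeta>"
    using sub[of "cnj \<zeta>"] by (intro image_mono) simp
  finally show ?thesis using sub by blast
qed

lemma max_mult_cnj: "max_mult A T (cnj \<zeta>) = max_mult A T \<zeta>"
  by (simp add: max_mult_def freqs_at_cnj image_image freq_mult_uminus)

context skew_eigenbasis
begin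

definition total_mult :: "real \<Rightarrow> nat" where
  "total_mult T = (\<Sum>\<zeta>\<in>phase_spectrum A T. max_mult A T \<zeta>)"

lemma finite_phase_spectrum: "finite (phase_spectrum A T)"
  by (simp add: phase_spectrum_eq finite_freqs)

lemma finite_freqs_at: "finite (freqs_at A T \<zeta>)"
  by (simp add: freqs_at_def finite_freqs)

lemma freq_mult_le_max_mult: "\<omega> \<in> freqs A \<Longrightarrow> freq_mult A \<omega> \<le> max_mult A T (phase T \<omega>)"
  unfolding max_mult_def by (intro Max_ge) (auto simp: freqs_at_def finite_freqs)

text \<open>This index set has the asserted cardinality. It serves both for the test vectors of the
  lower bound and for the rank-one terms of the construction.\<close>

definition slots :: "real \<Rightarrow> (complex \<times> nat) set" where
  "slots T = (SIGMA \<zeta>:phase_spectrum A T. {..<max_mult A T \<zeta>})"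

lemma finite_slots: "finite (slots T)"
  by (simp add: slots_def finite_phase_spectrum)

lemma card_slots: "card (slots T) = total_mult T"
  by (simp add: slots_def card_SigmaI finite_phase_spectrum total_mult_def)

text \<open>For each phase a frequency \<open>s \<zeta>\<close> of maximal multiplicity is selected.
  Compressed to the selected eigenspaces, \<open>X\<close> is \<open>c / T\<close> times the
  identity, so its rank is at least their total dimension.\<close>

lemma total_mult_le_rank:
  assumes T: "T > 0" and X: "gramian A T X = c *\<^sub>R mat 1" and c: "c \<noteq> 0"
  shows "total_mult T \<le> rank X"
proof -
  have "\<exists>\<omega>. \<omega> \<in> freqs_at A T \<zeta> \<and> max_mult A T \<zeta> = freq_mult A \<omega>" if "\<zeta> \<in> phase_spectrum A T" for \<zeta>
  proof -
    have "freqs_at A T \<zeta> \<noteq> {}" using that by (auto simp: phase_spectrum_eq freqs_at_def)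
    then have "max_mult A T \<zeta> \<in> freq_mult A ` freqs_at A T \<zeta>"
      unfolding max_mult_def by (intro Max_in) (auto simp: finite_freqs_at)
    then show ?thesis by blast
  qed
  then obtain s where s: "\<And>\<zeta>. \<zeta> \<in> phase_spectrum A T \<Longrightarrow> s \<zeta> \<in> freqs_at A T \<zeta> \<and> max_mult A T \<zeta> = freq_mult A (s \<zeta>)"
    by metis
  have "card (slots T) \<le> rank X"
  proof (rule card_le_rank[where e = "\<lambda>p. u (s (fst p)) (snd p)" and c = "of_real (c / T)"])
    show "finite (slots T)" by (rule finite_slots)
    show "complex_of_real (c / T) \<noteq> 0" using T c by simp
    fix p q assume pq: "p \<in> slots T" "q \<in> slots T"
    obtain \<zeta> j where p: "p = (\<zeta>, j)" by (cases p)
    obtain \<eta> l where q: "q = (\<eta>, l)" by (cases q)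
    have m: "(s \<zeta>, j) \<in> modes" "(s \<eta>, l) \<in> modes" and ph: "phase T (s \<zeta>) = \<zeta>" "phase T (s \<eta>) = \<eta>"
      using pq s[of \<zeta>] s[of \<eta>] by (auto simp: slots_def p q modes_def freqs_at_def)
    let ?c = "cdot (complexify X *v u (s \<zeta>) j) (u (s \<eta>) l)"
    have eq: "phase_integral T (s \<eta> - s \<zeta>) * ?c = (if (s \<zeta>, j) = (s \<eta>, l) then of_real c else 0)"
      using gramian_scalar_iff[THEN iffD1, OF X] m by fastforce
    show "cdot (complexify X *v u (s (fst p)) (snd p)) (u (s (fst q)) (snd q)) = (if p = q then of_real (c / T) else 0)"
    \<comment> \<open>Equal phases have the same selected frequency, where the integral is
      \<open>T\<close>; for different phases the integral is nonzero, so the entry of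
      \<open>X\<close> must vanish.\<close>
    proof (cases "\<zeta> = \<eta>")
      case True
      then show ?thesis using eq T by (auto simp: p q phase_integral_0 field_simps)
    next
      case False
      then have "phase_integral T (s \<eta> - s \<zeta>) \<noteq> 0" and "s \<zeta> \<noteq> s \<eta>"
        using ph by (auto simp: phase_integral_diff_eq_0[OF T])
      then show ?thesis using eq False by (auto simp: p q)
    qed
  qed
  then show ?thesis by (simp add: card_slots)
qed

section \<open>An optimal matrix of minimal rank\<close>

definition combined :: "real \<Rightarrow> complex \<times> nat \<Rightarrow> complex^'n" where
  "combined T p = (\<Sum>\<omega>\<in>freqs_at A T (fst p). u \<omega> (snd p))"

lemma combined_cnj: "combined T (cnj \<zeta>, j) = cnjv (combined T (\<zeta>, j))"
  by (simp add: combined_def freqs_at_cnj sum.reindex u_cnj cnjv_sum)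

lemma slots_cnj: "(cnj \<zeta>, j) \<in> slots T \<longleftrightarrow> (\<zeta>, j) \<in> slots T"
proof -
  have "cnj \<zeta> \<in> phase_spectrum A T" if "\<zeta> \<in> phase_spectrum A T" for \<zeta>
    using that by (auto simp: phase_spectrum_eq freqs_uminus simp flip: phase_uminus)
  from this[of \<zeta>] this[of "cnj \<zeta>"] show ?thesis by (auto simp: slots_def max_mult_cnj)
qed

lemma cdot_u_combined:
  "cdot (u \<nu> k) (combined T (\<zeta>, j)) = (if \<nu> \<in> freqs_at A T \<zeta> \<and> k = j \<and> k < freq_mult A \<nu> then 1 else 0)"
proof -
  have "cdot (u \<nu> k) (combined T (\<zeta>, j)) =
      (\<Sum>\<omega>\<in>freqs_at A T \<zeta>. if \<omega> = \<nu> then (if k = j \<and> k < freq_mult A \<nu> then 1 else 0) else 0)"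
    unfolding combined_def cdot_sum_right by (intro sum.cong) (auto simp: cdot_u)
  then show ?thesis by (simp add: finite_freqs_at)
qed

lemma optimal_matrix_exists:
  assumes T: "T > 0"
  obtains X where "psd X" "trace X = 1" "rank X \<le> total_mult T" "gramian A T X = (T / CARD('n)) *\<^sub>R mat 1"
proof -
  let ?n = "CARD('n)" and ?v = "combined T" and ?P = "slots T"
  define C :: "complex^'n^'n" where
    "C = (\<chi> a b. (\<Sum>p\<in>?P. ?v p $ a * cnj (?v p $ b)) / of_nat ?n)"
  define X :: "real^'n^'n" where "X = (\<chi> a b. Re (C $ a $ b))"
  have cnj_C: "cnj (C $ a $ b) = C $ a $ b" for a b
  proof -
    \<comment> \<open>Conjugation permutes the slots and conjugates their vectors, so the sum is
      real.\<close>
    have "(\<Sum>p\<in>?P. cnj (?v p $ a) * ?v p $ b) = (\<Sum>p\<in>?P. ?v p $ a * cnj (?v p $ b))"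
      by (rule sum.reindex_bij_witness[where i = "\<lambda>p. (cnj (fst p), snd p)" and j = "\<lambda>p. (cnj (fst p), snd p)"])
         (auto simp: slots_cnj combined_cnj cnjv_def)
    then show ?thesis by (simp add: C_def)
  qed
  have CX: "complexify X = C"
    using cnj_C by (simp add: complexify_def X_def vec_eq_iff complex_eq_iff)
  have Cv: "complexify X *v x = (1 / of_nat ?n) *s (\<Sum>p\<in>?P. cdot x (?v p) *s ?v p)" for x
  proof -
    have "(C *v x) $ a = ((1 / of_nat ?n) *s (\<Sum>p\<in>?P. cdot x (?v p) *s ?v p)) $ a" for a
    proof -
      have "(C *v x) $ a = (\<Sum>b\<in>UNIV. \<Sum>p\<in>?P. ?v p $ a * cnj (?v p $ b) * x $ b) / of_nat ?n"
        by (simp add: matrix_vector_mult_def C_def sum_distrib_right sum_divide_distrib)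
      also have "(\<Sum>b\<in>UNIV. \<Sum>p\<in>?P. ?v p $ a * cnj (?v p $ b) * x $ b)
          = (\<Sum>p\<in>?P. \<Sum>b\<in>UNIV. ?v p $ a * cnj (?v p $ b) * x $ b)"
        by (rule sum.swap)
      also have "\<dots> = (\<Sum>p\<in>?P. cdot x (?v p) * ?v p $ a)"
        by (simp add: cdot_def sum_distrib_left sum_distrib_right mult_ac)
      finally show ?thesis by (simp add: sum_component)
    qed
    then show ?thesis by (simp add: CX vec_eq_iff)
  qed
  have form: "cdot (complexify X *v x) y = (\<Sum>p\<in>?P. cdot x (?v p) * cdot (?v p) y) / of_nat ?n" for x y
    by (simp add: Cv cdot_scale_left cdot_sum_left)
  have psd: "psd X"
    unfolding psd_def
  proof (intro conjI allI)
    have herm: "C $ b $ a = cnj (C $ a $ b)" for a b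
      by (simp add: C_def mult.commute)
    have "Re (C $ b $ a) = Re (C $ a $ b)" for a b
      by (subst herm) simp
    then show "transpose X = X"
      by (simp add: transpose_def X_def vec_eq_iff)
    fix x
    have "complex_of_real (x \<bullet> (X *v x)) = cdot (complexify X *v cvec x) (cvec x)"
      by (simp add: complexify_cvec cdot_cvec inner_commute)
    also have "\<dots> = (\<Sum>p\<in>?P. cdot (cvec x) (?v p) * cnj (cdot (cvec x) (?v p))) / of_nat ?n"
      by (simp add: form cnj_cdot)
    also have "\<dots> = complex_of_real ((\<Sum>p\<in>?P. (cmod (cdot (cvec x) (?v p)))\<^sup>2) / ?n)"
      by (simp only: complex_norm_square[symmetric] of_real_divide of_real_sum of_real_power of_real_of_nat_eq)
    finally have "x \<bullet> (X *v x) = (\<Sum>p\<in>?P. (cmod (cdot (cvec x) (?v p)))\<^sup>2) / ?n"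
      by (simp only: of_real_eq_iff)
    then show "0 \<le> x \<bullet> (X *v x)" by (simp add: sum_nonneg)
  qed
  have "rank X \<le> card (?v ` ?P)"
    by (rule rank_le_card)
       (auto simp: Cv finite_slots intro!: vec.span_scale vec.span_sum intro: vec.span_base)
  also have "\<dots> \<le> card ?P" by (intro card_image_le finite_slots)
  finally have rank: "rank X \<le> total_mult T" by (simp add: card_slots)
  have gram: "gramian A T X = (T / ?n) *\<^sub>R mat 1"
    unfolding gramian_scalar_iff
  proof (intro ballI)
    fix p q assume pq: "p \<in> modes" "q \<in> modes"
    obtain \<nu> k where p: "p = (\<nu>, k)" by (cases p)
    obtain \<omega> l where q: "q = (\<omega>, l)" by (cases q)
    have \<nu>: "\<nu> \<in> freqs A" "k < freq_mult A \<nu>" and \<omega>: "\<omega> \<in> freqs A" "l < freq_mult A \<omega>"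
      using pq by (auto simp: p q modes_def)
    have slot: "(phase T \<nu>, k) \<in> ?P"
      using \<nu> freq_mult_le_max_mult[of \<nu> T] by (auto simp: slots_def phase_spectrum_eq)
    \<comment> \<open>The vector \<open>u \<nu> k\<close> pairs nontrivially only with the combined
      vector of its own phase and index, so one term survives.\<close>
    have "(\<Sum>z\<in>?P. cdot (u \<nu> k) (?v z) * cdot (?v z) (u \<omega> l))
        = (\<Sum>z\<in>?P. if z = (phase T \<nu>, k) then (if phase T \<omega> = phase T \<nu> \<and> k = l then 1 else 0) else 0)"
    proof (intro sum.cong refl)
      fix z :: "complex \<times> nat"
      obtain \<zeta> j where z: "z = (\<zeta>, j)" by (cases z)
      have "cdot (?v z) (u \<omega> l) = cnj (cdot (u \<omega> l) (?v z))" by (simp add: cnj_cdot)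
      then show "cdot (u \<nu> k) (?v z) * cdot (?v z) (u \<omega> l)
         = (if z = (phase T \<nu>, k) then (if phase T \<omega> = phase T \<nu> \<and> k = l then 1 else 0) else 0)"
        using \<nu> \<omega> by (auto simp: z cdot_u_combined freqs_at_def)
    qed
    also have "\<dots> = (if phase T \<omega> = phase T \<nu> \<and> k = l then 1 else 0)"
      using slot by (simp add: finite_slots)
    finally have "cdot (complexify X *v u \<nu> k) (u \<omega> l) = (if phase T \<omega> = phase T \<nu> \<and> k = l then 1 else 0) / of_nat ?n"
      by (simp add: form)
    \<comment> \<open>Entries of \<open>X\<close> between distinct frequencies of one phase are
      nonzero when the indices agree; the integral annihilates them in the Gramian.\<close>
    moreover have "phase_integral T (\<omega> - \<nu>) = 0" if "phase T \<omega> = phase T \<nu>" "\<omega> \<noteq> \<nu>"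
      using that by (simp add: phase_integral_diff_eq_0[OF T])
    ultimately show "phase_integral T (fst q - fst p) * cdot (complexify X *v w p) (w q) =
        (if p = q then of_real (T / ?n) else 0)"
      by (auto simp: p q phase_integral_0[OF T])
  qed
  \<comment> \<open>The trace of \<open>X\<close> is read off from the Gramian just
    computed.\<close>
  have "T * trace X = trace ((T / ?n) *\<^sub>R mat 1 :: real^'n^'n)"
    using trace_gramian[OF T, of X] gram by simp
  also have "\<dots> = T" by (simp add: linear_scale[OF linear_trace] trace_I)
  finally have "trace X = 1" using T by simp
  with psd rank gram that show ?thesis by blast
qed

section \<open>Optimal values and the rank formula\<close>

text \<open>The Gramian has trace \<open>T\<close>, so these are the trace bound for the least
  eigenvalue and its equality case.\<close>

lemma gramian_lambda_min:
  assumes T: "T > 0" and X: "psd X" "trace X = 1"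
  shows "lambda_min (gramian A T X) \<le> T / CARD('n)"
    and "lambda_min (gramian A T X) = T / CARD('n) \<longleftrightarrow> gramian A T X = (T / CARD('n)) *\<^sub>R mat 1"
proof -
  have s: "transpose (gramian A T X) = gramian A T X"
    using X by (simp add: psd_def transpose_gramian)
  have t: "trace (gramian A T X) = T" using T X by (simp add: trace_gramian)
  show "lambda_min (gramian A T X) \<le> T / CARD('n)"
    using lambda_min_le_trace[OF s] t by simp
  show "lambda_min (gramian A T X) = T / CARD('n) \<longleftrightarrow> gramian A T X = (T / CARD('n)) *\<^sub>R mat 1"
    using lambda_min_eq_trace[OF s] t by (auto simp: lambda_min_scalar)
qed

lemma gamma_le: "T > 0 \<Longrightarrow> k \<ge> 1 \<Longrightarrow> gamma k A T \<le> T / CARD('n)"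
  using gamma_attained[of k T] gramian_lambda_min(1)[of T] by (auto simp: state_matrices_def)

text \<open>Attainment turns equality of values into a matrix of rank at most \<open>k\<close> with
  scalar Gramian, to which the lower rank bound applies. Conversely, the constructed optimal matrix
  is feasible for \<open>k\<close>.\<close>

lemma gamma_eq_iff:
  assumes T: "T > 0" and k: "k \<ge> 1"
  shows "gamma k A T = T / CARD('n) \<longleftrightarrow> total_mult T \<le> k"
proof
  assume eq: "gamma k A T = T / CARD('n)"
  obtain X where X: "psd X" "trace X = 1" "rank X \<le> k" "gamma k A T = lambda_min (gramian A T X)"
    using gamma_attained[OF k, of T] by (auto simp: state_matrices_def)
  then have "gramian A T X = (T / CARD('n)) *\<^sub>R mat 1"
    using gramian_lambda_min(2)[OF T X(1,2)] eq by simp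
  then have "total_mult T \<le> rank X" using T by (intro total_mult_le_rank) auto
  then show "total_mult T \<le> k" using X by simp
next
  assume le: "total_mult T \<le> k"
  obtain X where X: "psd X" "trace X = 1" "rank X \<le> total_mult T" "gramian A T X = (T / CARD('n)) *\<^sub>R mat 1"
    using optimal_matrix_exists[OF T] .
  then have "X \<in> state_matrices k" using le by (simp add: state_matrices_def)
  from gamma_upper[OF k this, of T] have "T / CARD('n) \<le> gamma k A T"
    by (simp add: X lambda_min_scalar)
  then show "gamma k A T = T / CARD('n)" using gamma_le[OF T k] by simp
qed

text \<open>In each phase class the maximum is at most the sum, and the classes partition the
  frequencies. Hence rank \<open>CARD('n)\<close> always suffices, which identifies
  \<open>gamma_rel\<close>.\<close>

lemma total_mult_le_dim: "T > 0 \<Longrightarrow> total_mult T \<le> CARD('n)"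
proof -
  assume T: "T > 0"
  have "total_mult T \<le> (\<Sum>\<zeta>\<in>phase_spectrum A T. \<Sum>\<omega>\<in>freqs_at A T \<zeta>. freq_mult A \<omega>)"
    unfolding total_mult_def
  proof (rule sum_mono)
    fix \<zeta> assume "\<zeta> \<in> phase_spectrum A T"
    then have "freqs_at A T \<zeta> \<noteq> {}" by (auto simp: phase_spectrum_eq freqs_at_def)
    then show "max_mult A T \<zeta> \<le> (\<Sum>\<omega>\<in>freqs_at A T \<zeta>. freq_mult A \<omega>)"
      unfolding max_mult_def
      by (intro Max.boundedI) (auto simp: finite_freqs_at intro!: member_le_sum)
  qed
  also have "\<dots> = (\<Sum>\<omega>\<in>freqs A. freq_mult A \<omega>)"
    unfolding freqs_at_def phase_spectrum_eq
    by (intro sum.group) (auto simp: finite_freqs)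
  finally show ?thesis by (simp add: sum_freq_mult)
qed

lemma gamma_rel_eq: "T > 0 \<Longrightarrow> gamma_rel A T = T / CARD('n)"
  unfolding gamma_rel_def using gamma_eq_iff[of T "CARD('n)"] total_mult_le_dim[of T] by (simp add: Suc_leI)

lemma min_rank_eq:
  assumes T: "T > 0"
  shows "min_rank A T = total_mult T"
  unfolding min_rank_def gamma_rel_eq[OF T]
proof (rule Least_equality)
  \<comment> \<open>Optimality forces a scalar Gramian, to which the lower rank bound
    applies.\<close>
  have lb: "total_mult T \<le> rank X"
    if "psd X" "trace X = 1" "lambda_min (gramian A T X) = T / CARD('n)" for X
    using gramian_lambda_min(2)[OF T that(1,2)] that(3) T total_mult_le_rank[of T X "T / CARD('n)"] by simp
  obtain X where X: "psd X" "trace X = 1" "rank X \<le> total_mult T" "gramian A T X = (T / CARD('n)) *\<^sub>R mat 1"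
    using optimal_matrix_exists[OF T] .
  then have min: "lambda_min (gramian A T X) = T / CARD('n)"
    by (simp only: lambda_min_scalar)
  then have "total_mult T = rank X"
    using lb[OF X(1,2)] X(3) by (intro antisym)
  with X(1,2) min show "\<exists>X. psd X \<and> trace X = 1 \<and> lambda_min (gramian A T X) = T / CARD('n) \<and> total_mult T = rank X"
    by blast
  show "total_mult T \<le> d"
    if "\<exists>X. psd X \<and> trace X = 1 \<and> lambda_min (gramian A T X) = T / CARD('n) \<and> d = rank X" for d
    using that lb by blast
qed

lemma total_mult_distinct:
  assumes "inj_on (phase T) (freqs A)"
  shows "total_mult T = CARD('n)"
proof -
  have "freqs_at A T (phase T \<omega>) = {\<omega>}" if "\<omega> \<in> freqs A" for \<omega>
    using assms that by (auto simp: freqs_at_def inj_on_def)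
  then show ?thesis
    by (simp add: total_mult_def phase_spectrum_eq sum.reindex[OF assms] max_mult_def flip: sum_freq_mult)
qed

lemma total_mult_coincident:
  assumes "\<forall>\<omega>\<in>freqs A. \<forall>\<nu>\<in>freqs A. phase T \<omega> = phase T \<nu>"
  shows "total_mult T = Max (freq_mult A ` freqs A)"
proof -
  \<comment> \<open>The multiplicities sum to the positive number \<open>CARD('n)\<close>, so some
    frequency exists.\<close>
  have "freqs A \<noteq> {}" using sum_freq_mult by auto
  then obtain \<omega> where \<omega>: "\<omega> \<in> freqs A" by blast
  have eq: "phase T \<nu> = phase T \<omega>" if "\<nu> \<in> freqs A" for \<nu>
    using assms \<omega> that by blast
  have "phase T ` freqs A = {phase T \<omega>}" using eq \<omega> by blast
  moreover have "freqs_at A T (phase T \<omega>) = freqs A"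
    by (auto simp: freqs_at_def eq)
  ultimately show ?thesis by (simp add: total_mult_def phase_spectrum_eq max_mult_def)
qed

end

theorem theorem3p4:
  fixes A :: "real^'n^'n" and T :: real
  assumes "transpose A = - A" and "T > 0"
  shows "min_rank A T = (\<Sum>\<zeta>\<in>phase_spectrum A T. max_mult A T \<zeta>)
    \<and> (\<forall>k\<in>{1..CARD('n)}.
         (gamma k A T = gamma_rel A T \<and> gamma_rel A T = T / real CARD('n)) \<longleftrightarrow>
         k \<ge> (\<Sum>\<zeta>\<in>phase_spectrum A T. max_mult A T \<zeta>))
    \<and> ((\<forall>\<omega>\<in>freqs A. \<forall>\<nu>\<in>freqs A. \<omega> \<noteq> \<nu> \<longrightarrow> phase T \<omega> \<noteq> phase T \<nu>)
         \<longrightarrow> min_rank A T = CARD('n))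
    \<and> ((\<forall>\<omega>\<in>freqs A. \<forall>\<nu>\<in>freqs A. phase T \<omega> = phase T \<nu>)
         \<longrightarrow> min_rank A T = Max (freq_mult A ` freqs A))"
proof -
  obtain u where u: "\<And>\<omega> j. u \<omega> j \<in> eigspace A \<omega>"
    "\<And>\<omega> j. j \<ge> freq_mult A \<omega> \<Longrightarrow> u \<omega> j = 0"
    "\<And>\<omega>. orthonormal_family {..<freq_mult A \<omega>} (u \<omega>)"
    "\<And>\<omega> v. v \<in> eigspace A \<omega> \<Longrightarrow> v = (\<Sum>j<freq_mult A \<omega>. cdot v (u \<omega> j) *s u \<omega> j)"
    "\<And>\<omega> j. u (- \<omega>) j = cnjv (u \<omega> j)"
    using conjugation_invariant_eigenbasis[of A] by blast
  \<comment> \<open>The claim does not mention \<open>u\<close>, so any conjugation-compatible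
    eigenbasis may instantiate the locale.\<close>
  interpret skew_eigenbasis A u
    by unfold_locales (fact assms(1) u)+
  show ?thesis
    unfolding total_mult_def[symmetric]
  proof (intro conjI impI ballI)
    show "min_rank A T = total_mult T" by (rule min_rank_eq[OF assms(2)])
    then show "(\<forall>\<omega>\<in>freqs A. \<forall>\<nu>\<in>freqs A. \<omega> \<noteq> \<nu> \<longrightarrow> phase T \<omega> \<noteq> phase T \<nu>) \<Longrightarrow> min_rank A T = CARD('n)"
      and "(\<forall>\<omega>\<in>freqs A. \<forall>\<nu>\<in>freqs A. phase T \<omega> = phase T \<nu>) \<Longrightarrow> min_rank A T = Max (freq_mult A ` freqs A)"
      using total_mult_distinct[of T] total_mult_coincident[of T] unfolding inj_on_def by metis+
    fix k assume "k \<in> {1..CARD('n)}"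
    then have "k \<ge> 1" by simp
    then show "(gamma k A T = gamma_rel A T \<and> gamma_rel A T = T / real CARD('n)) \<longleftrightarrow> total_mult T \<le> k"
      using gamma_rel_eq[OF assms(2)] gamma_eq_iff[OF assms(2), of k] by simp
  qed
qed

end
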